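(* Let $(\mathfrak g,r,Z)$ be a finite dimensional coboundary Lie bialgebra over a field $\mathbb K$ of characteristic $0$ which admits a twist quantization $(J,\Phi)$ (not necessarily admissible). Then there exist a quantization $\mathcal O_{G,\hbar}$ of the Poisson formal series Hopf algebra $\mathcal O_G$ and an injective $\mathbb K[[\hbar]]$-algebra morphism $$\mathcal O_G^{\mathfrak g}[[\hbar]]\hookrightarrow\mathcal O_{G,\hbar}$$ deforming the inclusion $\mathcal O_G^{\mathfrak g}\subset\mathcal O_G$ (i.e. reducing to it modulo $\hbar$), where $\mathcal O_G^{\mathfrak g}[[\hbar]]$ is the trivial deformation of the commutative algebra $\mathcal O_G^{\mathfrak g}$.
   Context: A coboundary Lie bialgebra $(\mathfrak g,r,Z)$ is a Lie bialgebra $\mathfrak g$ with $r\in\wedge^2(\mathfrak g)$ such that the cobracket is $\delta(x)=[x\otimes1+1\otimes x,r]$, where $Z=\mathrm{CYB}(r)=[r^{1,2},r^{1,3}]+[r^{1,2},r^{2,3}]+[r^{1,3},r^{2,3}]\in\wedge^3(\mathfrak g)^{\mathfrak g}$. A twist quantization of $(\mathfrak g,r,Z)$ is a pair $(J,\Phi)$, $J\in U(\mathfrak g)^{\otimes2}[[\hbar]]$, $\Phi\in U(\mathfrak g)^{\otimes3}[[\hbar]]$, with $\Phi$ $\mathfrak g$-invariant, $J^{1,2}J^{12,3}=J^{2,3}J^{1,23}\Phi$ (where $J^{12,3}=(\Delta_0\otimes\mathrm{id})(J)$, $J^{1,23}=(\mathrm{id}\otimes\Delta_0)(J)$, $\Delta_0$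 the cocommutative coproduct), $(\varepsilon\otimes\mathrm{id})(J)=(\mathrm{id}\otimes\varepsilon)(J)=1$, $J=1^{\otimes2}+O(\hbar)$, $\Phi=1^{\otimes3}+O(\hbar)$, $\mathrm{Alt}((J-1^{\otimes2})/\hbar)=r+O(\hbar)$, $\mathrm{Alt}((\Phi-1^{\otimes3})/\hbar^2)=Z+O(\hbar)$, with $\mathrm{Alt}=\sum_{\tau}\mathrm{sgn}(\tau)\tau$. $G$ is the formal Poisson–Lie group with Lie bialgebra $\mathfrak g$; $\mathcal O_G=U(\mathfrak g)^*$ is its function ring: a Poisson formal series Hopf (PFSH) algebra with product dual to $\Delta_0$, coproduct dual to the product of $U(\mathfrak g)$, and Poisson bracket dual to the co-Poisson map extending $\delta$. $\mathfrak g$ acts on $\mathcal O_G$ by conjugation; $\mathcal O_G^{\mathfrak g}=\{f\in U(\mathfrak g)^*\mid f(xy)=f(yx)\ \forall x,y\in U(\mathfrak g)\}$ is the subalgebra of invariants. A quantization of a PFSH algebra $\mathcal O$ is a topologically free topological Hopf algebra $\mathcal O_\hbar$ over $\mathbb K[[\hbar]]$ (a QFSH algebra) with an isomorphism of Hopf algebras $\mathcal O_\hbar/\hbar\mathcal O_\hbar\simeq\mathcal O$ under which the Poisson bracket induced by $\hbar^{-1}[\cdot,\cdot]$ is that of $\mathcal O$. *)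

theory Defs
  imports
    "HOL-Analysis.Function_Topology"
    "HOL-Computational_Algebra.Formal_Power_Series"
    "HOL-Library.Poly_Mapping"
    "HOL-Library.Function_Algebras"
begin

section \<open>Vector spaces given by generators and relations\<close>

definition free_scale :: "'k::field \<Rightarrow> ('x, 'k) poly_mapping \<Rightarrow> ('x, 'k) poly_mapping"
  where "free_scale c p = Poly_Mapping.map ((*) c) p"

definition lin_ext ::
    "('k::field \<Rightarrow> 'w::ab_group_add \<Rightarrow> 'w) \<Rightarrow> ('x \<Rightarrow> 'w) \<Rightarrow> ('x, 'k) poly_mapping \<Rightarrow> 'w"
  where "lin_ext s e p = (\<Sum>x\<in>Poly_Mapping.keys p. s (Poly_Mapping.lookup p x) (e x))"

text \<open>The vector space \<open>('w, s)\<close>, with the family \<open>e\<close> of its elements, is (a copy of) the quotient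
  of the free vector space on \<open>'x\<close> by the span of \<open>R\<close>. A quotient that depends on terms cannot be
  formed as a type, so the enveloping algebra and its tensor powers below are arbitrary types
  carrying such a presentation, i.e. they range over all copies of the quotient.\<close>

definition presented_by ::
    "('k::field \<Rightarrow> 'w::ab_group_add \<Rightarrow> 'w) \<Rightarrow> ('x \<Rightarrow> 'w) \<Rightarrow> ('x, 'k) poly_mapping set \<Rightarrow> bool"
  where "presented_by s e R \<longleftrightarrow>
    vector_space s \<and> surj (lin_ext s e) \<and> {p. lin_ext s e p = 0} = module.span free_scale R"

definition algebra_over :: "('k::field \<Rightarrow> 'a::ring_1 \<Rightarrow> 'a) \<Rightarrow> bool"
  where "algebra_over s \<longleftrightarrow> vector_space s \<and>
    (\<forall>c x y. s c x * y = s c (x * y) \<and> x * s c y = s c (x * y))"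

definition algebra_hom ::
    "('k::field \<Rightarrow> 'a::ring_1 \<Rightarrow> 'a) \<Rightarrow> ('k \<Rightarrow> 'b::ring_1 \<Rightarrow> 'b) \<Rightarrow> ('a \<Rightarrow> 'b) \<Rightarrow> bool"
  where "algebra_hom s s' h \<longleftrightarrow>
    Vector_Spaces.linear s s' h \<and> h 1 = 1 \<and> (\<forall>x y. h (x * y) = h x * h y)"

definition tensor_rels ::
    "('k::field \<Rightarrow> 'v::ab_group_add \<Rightarrow> 'v) \<Rightarrow> ('k \<Rightarrow> 'w::ab_group_add \<Rightarrow> 'w) \<Rightarrow>
      ('v \<times> 'w, 'k) poly_mapping set"
  where "tensor_rels s s' =
    {Poly_Mapping.single (x + x', y) 1 - Poly_Mapping.single (x, y) 1 -
       Poly_Mapping.single (x', y) 1 | x x' y. True} \<union>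
    {Poly_Mapping.single (x, y + y') 1 - Poly_Mapping.single (x, y) 1 -
       Poly_Mapping.single (x, y') 1 | x y y'. True} \<union>
    {Poly_Mapping.single (s c x, y) 1 - Poly_Mapping.single (x, y) c | c x y. True} \<union>
    {Poly_Mapping.single (x, s' c y) 1 - Poly_Mapping.single (x, y) c | c x y. True}"

definition tensor_product_algebra ::
    "('k::field \<Rightarrow> 'a::ring_1 \<Rightarrow> 'a) \<Rightarrow> ('k \<Rightarrow> 'b::ring_1 \<Rightarrow> 'b) \<Rightarrow> ('k \<Rightarrow> 'c::ring_1 \<Rightarrow> 'c) \<Rightarrow>
      ('a \<Rightarrow> 'b \<Rightarrow> 'c) \<Rightarrow> bool"
  where "tensor_product_algebra s s' s2 t \<longleftrightarrow>
    presented_by s2 (\<lambda>(x, y). t x y) (tensor_rels s s') \<and>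
    algebra_over s2 \<and> t 1 1 = 1 \<and> (\<forall>x y x' y'. t x y * t x' y' = t (x * x') (y * y'))"


section \<open>Lie algebras and enveloping algebras\<close>

definition lie_algebra :: "('k::field \<Rightarrow> 'g::ab_group_add \<Rightarrow> 'g) \<Rightarrow> ('g \<Rightarrow> 'g \<Rightarrow> 'g) \<Rightarrow> bool"
  where "lie_algebra s br \<longleftrightarrow>
    vector_space s \<and>
    (\<forall>x. Vector_Spaces.linear s s (br x)) \<and> (\<forall>y. Vector_Spaces.linear s s (\<lambda>x. br x y)) \<and>
    (\<forall>x. br x x = 0) \<and>
    (\<forall>x y z. br x (br y z) + br y (br z x) + br z (br x y) = 0)"

text \<open>A word \<open>[x\<^sub>1, \<dots>, x\<^sub>n]\<close> stands for the noncommutative monomial \<open>x\<^sub>1 \<cdots> x\<^sub>n\<close>; the relations span the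
  two-sided ideal defining \<open>U(\<gg>)\<close> in the free associative algebra on the underlying set of \<open>\<gg>\<close>.\<close>

definition enveloping_rels ::
    "('k::field \<Rightarrow> 'g::ab_group_add \<Rightarrow> 'g) \<Rightarrow> ('g \<Rightarrow> 'g \<Rightarrow> 'g) \<Rightarrow> ('g list, 'k) poly_mapping set"
  where "enveloping_rels s br =
    {Poly_Mapping.single (u @ [x + y] @ v) 1 - Poly_Mapping.single (u @ [x] @ v) 1 -
       Poly_Mapping.single (u @ [y] @ v) 1 | u x y v. True} \<union>
    {Poly_Mapping.single (u @ [s c x] @ v) 1 - Poly_Mapping.single (u @ [x] @ v) c | u c x v. True} \<union>
    {Poly_Mapping.single (u @ [x, y] @ v) 1 - Poly_Mapping.single (u @ [y, x] @ v) 1 -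
       Poly_Mapping.single (u @ [br x y] @ v) 1 | u x y v. True}"

definition enveloping_algebra ::
    "('k::field \<Rightarrow> 'g::ab_group_add \<Rightarrow> 'g) \<Rightarrow> ('g \<Rightarrow> 'g \<Rightarrow> 'g) \<Rightarrow> ('k \<Rightarrow> 'u::ring_1 \<Rightarrow> 'u) \<Rightarrow>
      ('g \<Rightarrow> 'u) \<Rightarrow> bool"
  where "enveloping_algebra s br su j \<longleftrightarrow>
    algebra_over su \<and> presented_by su (\<lambda>w. prod_list (map j w)) (enveloping_rels s br)"

text \<open>The Lie algebra \<open>\<gg>\<close>, \<open>U = U(\<gg>)\<close>, \<open>U \<otimes> U\<close> and \<open>U \<otimes> U \<otimes> U = (U \<otimes> U) \<otimes> U\<close>.\<close>

record ('k, 'g, 'u, 'uu, 'uuu) enveloping =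
  gscale :: "'k \<Rightarrow> 'g \<Rightarrow> 'g"
  gbracket :: "'g \<Rightarrow> 'g \<Rightarrow> 'g"
  uscale :: "'k \<Rightarrow> 'u \<Rightarrow> 'u"
  incl :: "'g \<Rightarrow> 'u"
  uuscale :: "'k \<Rightarrow> 'uu \<Rightarrow> 'uu"
  ten :: "'u \<Rightarrow> 'u \<Rightarrow> 'uu"
  uuuscale :: "'k \<Rightarrow> 'uuu \<Rightarrow> 'uuu"
  ten21 :: "'uu \<Rightarrow> 'u \<Rightarrow> 'uuu"

type_synonym ('k, 'g, 'u, 'uu, 'uuu) env = "('k, 'g, 'u, 'uu, 'uuu) enveloping"

definition is_enveloping ::
    "('k::field, 'g::ab_group_add, 'u::ring_1, 'uu::ring_1, 'uuu::ring_1) env \<Rightarrow> bool"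
  where "is_enveloping E \<longleftrightarrow>
    lie_algebra (gscale E) (gbracket E) \<and>
    enveloping_algebra (gscale E) (gbracket E) (uscale E) (incl E) \<and>
    tensor_product_algebra (uscale E) (uscale E) (uuscale E) (ten E) \<and>
    tensor_product_algebra (uuscale E) (uscale E) (uuuscale E) (ten21 E)"

definition finite_dimensional :: "('k::field \<Rightarrow> 'g::ab_group_add \<Rightarrow> 'g) \<Rightarrow> bool"
  where "finite_dimensional s \<longleftrightarrow> (\<exists>B. finite_dimensional_vector_space s B)"

definition ten3 ::
    "('k, 'g, 'u, 'uu, 'uuu) env \<Rightarrow> 'u \<Rightarrow> 'u \<Rightarrow> 'u \<Rightarrow> 'uuu"
  where "ten3 E x y z = ten21 E (ten E x y) z"

text \<open>The linear maps on \<open>U \<otimes> U\<close> and \<open>U \<otimes> U \<otimes> U\<close> induced by a bilinear, resp. trilinear, map \<open>f\<close>.\<close>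

definition lift2 ::
    "('k::field, 'g, 'u, 'uu::ab_group_add, 'uuu) env \<Rightarrow> ('k \<Rightarrow> 'w::ab_group_add \<Rightarrow> 'w) \<Rightarrow>
      ('u \<Rightarrow> 'u \<Rightarrow> 'w) \<Rightarrow> 'uu \<Rightarrow> 'w"
  where "lift2 E s f =
    (THE h. Vector_Spaces.linear (uuscale E) s h \<and> (\<forall>x y. h (ten E x y) = f x y))"

definition lift3 ::
    "('k::field, 'g, 'u, 'uu, 'uuu::ab_group_add) env \<Rightarrow> ('k \<Rightarrow> 'w::ab_group_add \<Rightarrow> 'w) \<Rightarrow>
      ('u \<Rightarrow> 'u \<Rightarrow> 'u \<Rightarrow> 'w) \<Rightarrow> 'uuu \<Rightarrow> 'w"
  where "lift3 E s f =
    (THE h. Vector_Spaces.linear (uuuscale E) s h \<and> (\<forall>x y z. h (ten3 E x y z) = f x y z))"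

definition coprod0 ::
    "('k::field, 'g, 'u::ring_1, 'uu::ring_1, 'uuu) env \<Rightarrow> 'u \<Rightarrow> 'uu"
  where "coprod0 E =
    (THE D. algebra_hom (uscale E) (uuscale E) D \<and>
       (\<forall>x. D (incl E x) = ten E (incl E x) 1 + ten E 1 (incl E x)))"

definition counit0 :: "('k::field, 'g, 'u::ring_1, 'uu, 'uuu) env \<Rightarrow> 'u \<Rightarrow> 'k"
  where "counit0 E = (THE e. algebra_hom (uscale E) (*) e \<and> (\<forall>x. e (incl E x) = 0))"

text \<open>Leg notation: \<open>leg12 E T\<close> is \<open>T\<^sup>1\<^sup>,\<^sup>2 = T \<otimes> 1\<close>, \<open>leg12_3 E T\<close> is \<open>T\<^sup>1\<^sup>2\<^sup>,\<^sup>3 = (\<Delta>\<^sub>0 \<otimes> id)(T)\<close>, etc.\<close>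

definition leg12 :: "('k, 'g, 'u::ring_1, 'uu, 'uuu) env \<Rightarrow> 'uu \<Rightarrow> 'uuu"
  where "leg12 E T = ten21 E T 1"

definition leg13 ::
    "('k::field, 'g, 'u::ring_1, 'uu::ring_1, 'uuu::ring_1) env \<Rightarrow> 'uu \<Rightarrow> 'uuu"
  where "leg13 E = lift2 E (uuuscale E) (\<lambda>x y. ten3 E x 1 y)"

definition leg23 ::
    "('k::field, 'g, 'u::ring_1, 'uu::ring_1, 'uuu::ring_1) env \<Rightarrow> 'uu \<Rightarrow> 'uuu"
  where "leg23 E = lift2 E (uuuscale E) (\<lambda>x y. ten3 E 1 x y)"

definition leg12_3 ::
    "('k::field, 'g, 'u::ring_1, 'uu::ring_1, 'uuu::ring_1) env \<Rightarrow> 'uu \<Rightarrow> 'uuu"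
  where "leg12_3 E = lift2 E (uuuscale E) (\<lambda>x y. ten21 E (coprod0 E x) y)"

definition leg1_23 ::
    "('k::field, 'g, 'u::ring_1, 'uu::ring_1, 'uuu::ring_1) env \<Rightarrow> 'uu \<Rightarrow> 'uuu"
  where "leg1_23 E = lift2 E (uuuscale E)
    (\<lambda>x y. lift2 E (uuuscale E) (\<lambda>y' y''. ten3 E x y' y'') (coprod0 E y))"

definition alt2 :: "('k::field, 'g, 'u, 'uu::ring_1, 'uuu) env \<Rightarrow> 'uu \<Rightarrow> 'uu"
  where "alt2 E = lift2 E (uuscale E) (\<lambda>x y. ten E x y - ten E y x)"

definition alt3 :: "('k::field, 'g, 'u, 'uu, 'uuu::ring_1) env \<Rightarrow> 'uuu \<Rightarrow> 'uuu"
  where "alt3 E = lift3 E (uuuscale E)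
    (\<lambda>x y z. ten3 E x y z + ten3 E y z x + ten3 E z x y
           - ten3 E y x z - ten3 E x z y - ten3 E z y x)"

definition cyc3 :: "('k::field, 'g, 'u, 'uu, 'uuu::ring_1) env \<Rightarrow> 'uuu \<Rightarrow> 'uuu"
  where "cyc3 E = lift3 E (uuuscale E)
    (\<lambda>x y z. ten3 E x y z + ten3 E y z x + ten3 E z x y)"

definition commutator :: "'a::ring \<Rightarrow> 'a \<Rightarrow> 'a"
  where "commutator a b = a * b - b * a"


section \<open>Coboundary Lie bialgebras and twist quantizations\<close>

text \<open>Tensor powers of \<open>\<gg>\<close>, and thus their exterior powers, are regarded as subspaces of the tensor
  powers of \<open>U(\<gg>)\<close>, where the commutators in the defining formulas are taken.\<close>

definition wedge2 :: "('k::field, 'g, 'u, 'uu::ring_1, 'uuu) env \<Rightarrow> 'uu set"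
  where "wedge2 E = module.span (uuscale E)
    {ten E (incl E x) (incl E y) - ten E (incl E y) (incl E x) | x y. True}"

definition wedge3 :: "('k::field, 'g, 'u, 'uu, 'uuu::ring_1) env \<Rightarrow> 'uuu set"
  where "wedge3 E = module.span (uuuscale E)
    {alt3 E (ten3 E (incl E x) (incl E y) (incl E z)) | x y z. True}"

definition prim2 :: "('k, 'g, 'u::ring_1, 'uu::ring_1, 'uuu) env \<Rightarrow> 'g \<Rightarrow> 'uu"
  where "prim2 E x = ten E (incl E x) 1 + ten E 1 (incl E x)"

definition prim3 :: "('k, 'g, 'u::ring_1, 'uu, 'uuu::ring_1) env \<Rightarrow> 'g \<Rightarrow> 'uuu"
  where "prim3 E x = ten3 E (incl E x) 1 1 + ten3 E 1 (incl E x) 1 + ten3 E 1 1 (incl E x)"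

text \<open>The co-Poisson map on \<open>U(\<gg>)\<close> extending the cobracket \<open>\<delta>\<close>.\<close>

definition co_poisson ::
    "('k::field, 'g, 'u::ring_1, 'uu::ring_1, 'uuu) env \<Rightarrow> ('g \<Rightarrow> 'uu) \<Rightarrow> 'u \<Rightarrow> 'uu"
  where "co_poisson E \<delta> =
    (THE D. Vector_Spaces.linear (uscale E) (uuscale E) D \<and>
       (\<forall>x. D (incl E x) = \<delta> x) \<and>
       (\<forall>a b. D (a * b) = D a * coprod0 E b + coprod0 E a * D b))"

definition lie_bialgebra ::
    "('k::field, 'g::ab_group_add, 'u::ring_1, 'uu::ring_1, 'uuu::ring_1) env \<Rightarrow>
      ('g \<Rightarrow> 'uu) \<Rightarrow> bool"
  where "lie_bialgebra E \<delta> \<longleftrightarrow>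
    Vector_Spaces.linear (gscale E) (uuscale E) \<delta> \<and>
    range \<delta> \<subseteq> wedge2 E \<and>
    (\<forall>x y. \<delta> (gbracket E x y) = commutator (prim2 E x) (\<delta> y) - commutator (prim2 E y) (\<delta> x)) \<and>
    (\<forall>x. cyc3 E (lift2 E (uuuscale E) (\<lambda>a b. ten21 E (co_poisson E \<delta> a) b) (\<delta> x)) = 0)"

definition CYB :: "('k::field, 'g, 'u::ring_1, 'uu::ring_1, 'uuu::ring_1) env \<Rightarrow> 'uu \<Rightarrow> 'uuu"
  where "CYB E r =
    commutator (leg12 E r) (leg13 E r) + commutator (leg12 E r) (leg23 E r) +
    commutator (leg13 E r) (leg23 E r)"

definition coboundary_lie_bialgebra ::
    "('k::field, 'g::ab_group_add, 'u::ring_1, 'uu::ring_1, 'uuu::ring_1) env \<Rightarrow>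
      ('g \<Rightarrow> 'uu) \<Rightarrow> 'uu \<Rightarrow> 'uuu \<Rightarrow> bool"
  where "coboundary_lie_bialgebra E \<delta> r Z \<longleftrightarrow>
    lie_bialgebra E \<delta> \<and>
    r \<in> wedge2 E \<and>
    (\<forall>x. \<delta> x = commutator (prim2 E x) r) \<and>
    Z = CYB E r \<and> Z \<in> wedge3 E \<and> (\<forall>x. commutator (prim3 E x) Z = 0)"

definition fps_map :: "('a \<Rightarrow> 'b) \<Rightarrow> 'a fps \<Rightarrow> 'b fps"
  where "fps_map h F = Abs_fps (\<lambda>n. h (fps_nth F n))"

text \<open>\<open>(\<Phi> - 1) / \<hbar>\<^sup>2\<close> may have a pole, as \<open>\<Phi> = 1 + O(\<hbar>)\<close> only; \<open>Alt((\<Phi> - 1) / \<hbar>\<^sup>2) = Z + O(\<hbar>)\<close> says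
  that \<open>Alt(\<Phi> - 1)\<close> has vanishing coefficients below \<open>\<hbar>\<^sup>2\<close>, where its coefficient is \<open>Z\<close>.\<close>

definition twist_quantization ::
    "('k::field, 'g, 'u::ring_1, 'uu::ring_1, 'uuu::ring_1) env \<Rightarrow> 'uu \<Rightarrow> 'uuu \<Rightarrow>
      'uu fps \<Rightarrow> 'uuu fps \<Rightarrow> bool"
  where "twist_quantization E r Z J \<Phi> \<longleftrightarrow>
    (\<forall>x. commutator (fps_const (prim3 E x)) \<Phi> = 0) \<and>
    fps_map (leg12 E) J * fps_map (leg12_3 E) J =
      fps_map (leg23 E) J * fps_map (leg1_23 E) J * \<Phi> \<and>
    fps_map (lift2 E (uscale E) (\<lambda>x y. uscale E (counit0 E x) y)) J = 1 \<and>
    fps_map (lift2 E (uscale E) (\<lambda>x y. uscale E (counit0 E y) x)) J = 1 \<and>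
    fps_nth J 0 = 1 \<and>
    fps_nth \<Phi> 0 = 1 \<and>
    (let A = fps_map (alt2 E) (J - 1) in fps_nth A 0 = 0 \<and> fps_nth A 1 = r) \<and>
    (let A = fps_map (alt3 E) (\<Phi> - 1) in fps_nth A 0 = 0 \<and> fps_nth A 1 = 0 \<and> fps_nth A 2 = Z)"


section \<open>The Poisson formal series Hopf algebra of functions\<close>

text \<open>The structure maps of a PFSH algebra carried by the full dual of a vector space \<open>'v\<close>. The
  completed tensor square of the dual is the dual of the tensor square, i.e. it consists of the
  bilinear forms on \<open>'v\<close>, and \<open>f \<otimes> g\<close> is the form \<open>(x, y) \<mapsto> f(x) g(y)\<close>.\<close>

record ('k, 'v) pfsh =
  pscale :: "'k \<Rightarrow> 'v \<Rightarrow> 'v"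
  pmult :: "('v \<Rightarrow> 'k) \<Rightarrow> ('v \<Rightarrow> 'k) \<Rightarrow> 'v \<Rightarrow> 'k"
  pone :: "'v \<Rightarrow> 'k"
  pcoprod :: "('v \<Rightarrow> 'k) \<Rightarrow> 'v \<Rightarrow> 'v \<Rightarrow> 'k"
  pcounit :: "('v \<Rightarrow> 'k) \<Rightarrow> 'k"
  pbracket :: "('v \<Rightarrow> 'k) \<Rightarrow> ('v \<Rightarrow> 'k) \<Rightarrow> 'v \<Rightarrow> 'k"

definition dual :: "('k::field \<Rightarrow> 'v::ab_group_add \<Rightarrow> 'v) \<Rightarrow> ('v \<Rightarrow> 'k) set"
  where "dual s = {f. Vector_Spaces.linear s (*) f}"

definition functions_G ::
    "('k::field, 'g, 'u::ring_1, 'uu::ring_1, 'uuu) env \<Rightarrow> ('g \<Rightarrow> 'uu) \<Rightarrow> ('k, 'u) pfsh"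
  where "functions_G E \<delta> = \<lparr>
    pscale = uscale E,
    pmult = (\<lambda>f g x. lift2 E (*) (\<lambda>a b. f a * g b) (coprod0 E x)),
    pone = counit0 E,
    pcoprod = (\<lambda>f x y. f (x * y)),
    pcounit = (\<lambda>f. f 1),
    pbracket = (\<lambda>f g x. lift2 E (*) (\<lambda>a b. f a * g b) (co_poisson E \<delta> x))\<rparr>"

definition invariants :: "('k::field, 'g, 'u::ring_1, 'uu, 'uuu) env \<Rightarrow> ('u \<Rightarrow> 'k) set"
  where "invariants E = {f \<in> dual (uscale E). \<forall>x y. f (x * y) = f (y * x)}"


section \<open>QFSH algebras and quantizations\<close>

text \<open>A topologically free module whose reduction modulo \<open>\<hbar>\<close> is the dual of a vector space \<open>V\<close> is
  isomorphic to \<open>V\<^sup>*[[\<hbar>]]\<close>, i.e. to the module of \<open>K\<close>-linear maps \<open>V \<rightarrow> K[[\<hbar>]]\<close>, with the topology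
  of pointwise convergence for the \<open>\<hbar>\<close>-adic topology of \<open>K[[\<hbar>]]\<close> (this is the topology of the type
  class instances for functions and formal power series). QFSH algebras are taken on these
  modules; the completed tensor square of \<open>V\<^sup>*[[\<hbar>]]\<close> is \<open>(V \<otimes> V)\<^sup>*[[\<hbar>]]\<close>, the module of \<open>K\<close>-bilinear
  maps \<open>V \<times> V \<rightarrow> K[[\<hbar>]]\<close>.\<close>

definition dual_h :: "('k::field \<Rightarrow> 'v::ab_group_add \<Rightarrow> 'v) \<Rightarrow> ('v \<Rightarrow> 'k fps) set"
  where "dual_h s = {f. Vector_Spaces.linear s (\<lambda>c p. fps_const c * p) f}"

definition dual2_h :: "('k::field \<Rightarrow> 'v::ab_group_add \<Rightarrow> 'v) \<Rightarrow> ('v \<Rightarrow> 'v \<Rightarrow> 'k fps) set"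
  where "dual2_h s = {T. \<forall>a. T a \<in> dual_h s \<and> (\<lambda>b. T b a) \<in> dual_h s}"

definition act1 :: "'k::field fps \<Rightarrow> ('v \<Rightarrow> 'k fps) \<Rightarrow> 'v \<Rightarrow> 'k fps"
  where "act1 c f = (\<lambda>x. c * f x)"

definition act2 :: "'k::field fps \<Rightarrow> ('v \<Rightarrow> 'v \<Rightarrow> 'k fps) \<Rightarrow> 'v \<Rightarrow> 'v \<Rightarrow> 'k fps"
  where "act2 c T = (\<lambda>x y. c * T x y)"

definition cont_module_hom ::
    "('r \<Rightarrow> 'a \<Rightarrow> 'a) \<Rightarrow> ('r \<Rightarrow> 'b \<Rightarrow> 'b) \<Rightarrow> 'a set \<Rightarrow> 'b set \<Rightarrow>
      ('a::{plus,topological_space} \<Rightarrow> 'b::{plus,topological_space}) \<Rightarrow> bool"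
  where "cont_module_hom s s' A B h \<longleftrightarrow>
    (\<forall>a\<in>A. h a \<in> B) \<and>
    (\<forall>a\<in>A. \<forall>b\<in>A. h (a + b) = h a + h b) \<and>
    (\<forall>c. \<forall>a\<in>A. h (s c a) = s' c (h a)) \<and>
    continuous_on A h"

text \<open>\<open>qmult_hat\<close> is the product as a map on the completed tensor square.\<close>

record ('k, 'v) qfsh =
  qscale :: "'k \<Rightarrow> 'v \<Rightarrow> 'v"
  qmult_hat :: "('v \<Rightarrow> 'v \<Rightarrow> 'k fps) \<Rightarrow> 'v \<Rightarrow> 'k fps"
  qone :: "'v \<Rightarrow> 'k fps"
  qcoprod :: "('v \<Rightarrow> 'k fps) \<Rightarrow> 'v \<Rightarrow> 'v \<Rightarrow> 'k fps"
  qcounit :: "('v \<Rightarrow> 'k fps) \<Rightarrow> 'k fps"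
  qantipode :: "('v \<Rightarrow> 'k fps) \<Rightarrow> 'v \<Rightarrow> 'k fps"

definition qmult :: "('k::field, 'v) qfsh \<Rightarrow> ('v \<Rightarrow> 'k fps) \<Rightarrow> ('v \<Rightarrow> 'k fps) \<Rightarrow> 'v \<Rightarrow> 'k fps"
  where "qmult H f g = qmult_hat H (\<lambda>x y. f x * g y)"

text \<open>Under the above identification \<open>(h \<otimes> id)(T)\<close>, for a continuous linear endomorphism \<open>h\<close>, is
  computed slicewise as \<open>(x, y) \<mapsto> h(T(\<cdot>, y))(x)\<close>, and similarly for other codomains, for the other
  factor, and for more tensor factors.\<close>

definition qfsh_algebra :: "('k::field, 'v::ab_group_add) qfsh \<Rightarrow> bool"
  where "qfsh_algebra H \<longleftrightarrow>
    (let D = dual_h (qscale H); D2 = dual2_h (qscale H);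
         m = qmult_hat H; \<Delta> = qcoprod H; \<epsilon> = qcounit H; S = qantipode H in
     vector_space (qscale H) \<and>
     cont_module_hom act2 act1 D2 D m \<and>
     qone H \<in> D \<and>
     cont_module_hom act1 act2 D D2 \<Delta> \<and>
     cont_module_hom act1 (*) D UNIV \<epsilon> \<and>
     cont_module_hom act1 act1 D D S \<and>
     (\<forall>f\<in>D. \<forall>g\<in>D. \<forall>h\<in>D. qmult H (qmult H f g) h = qmult H f (qmult H g h)) \<and>
     (\<forall>f\<in>D. qmult H (qone H) f = f \<and> qmult H f (qone H) = f) \<and>
     (\<forall>f\<in>D. \<forall>x y z. \<Delta> (\<lambda>a. \<Delta> f a z) x y = \<Delta> (\<lambda>b. \<Delta> f x b) y z) \<and>
     (\<forall>f\<in>D. \<forall>x. \<epsilon> (\<lambda>a. \<Delta> f a x) = f x \<and> \<epsilon> (\<lambda>b. \<Delta> f x b) = f x) \<and>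
     (\<forall>f\<in>D. \<forall>g\<in>D. \<forall>x y.
        \<Delta> (qmult H f g) x y = m (\<lambda>a b. m (\<lambda>c d. \<Delta> f a c * \<Delta> g b d) y) x) \<and>
     (\<forall>x y. \<Delta> (qone H) x y = qone H x * qone H y) \<and>
     (\<forall>f\<in>D. \<forall>g\<in>D. \<epsilon> (qmult H f g) = \<epsilon> f * \<epsilon> g) \<and>
     \<epsilon> (qone H) = 1 \<and>
     (\<forall>f\<in>D. m (\<lambda>x y. S (\<lambda>a. \<Delta> f a y) x) = act1 (\<epsilon> f) (qone H)) \<and>
     (\<forall>f\<in>D. m (\<lambda>x y. S (\<lambda>b. \<Delta> f x b) y) = act1 (\<epsilon> f) (qone H)))"

text \<open>The isomorphism of topological Hopf algebras \<open>\<O>\<^sub>\<hbar> / \<hbar>\<O>\<^sub>\<hbar> \<simeq> \<O>\<close> is given as the surjection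
  \<open>\<pi> : \<O>\<^sub>\<hbar> \<rightarrow> \<O>\<close> with kernel \<open>\<hbar>\<O>\<^sub>\<hbar>\<close>. The dual of \<open>'v\<close> carries the topology of pointwise convergence for
  the discrete topology of \<open>K\<close>, which is the one induced by the inclusion of \<open>K\<close> in \<open>K[[\<hbar>]]\<close>. The
  condition for \<open>\<Delta>\<close> is \<open>(\<pi> \<otimes> \<pi>) \<circ> \<Delta>\<^sub>\<hbar> = \<Delta> \<circ> \<pi>\<close>, with \<open>\<pi> \<otimes> \<pi>\<close> computed slicewise.\<close>

definition reduction_iso ::
    "('k::field, 'v::ab_group_add) qfsh \<Rightarrow> (('v \<Rightarrow> 'k fps) \<Rightarrow> 'w \<Rightarrow> 'k) \<Rightarrow>
      ('k, 'w::ab_group_add) pfsh \<Rightarrow> bool"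
  where "reduction_iso H \<pi> P \<longleftrightarrow>
    (let D = dual_h (qscale H) in
     \<pi> ` D = dual (pscale P) \<and>
     (\<forall>f\<in>D. \<forall>g\<in>D. \<forall>x. \<pi> (f + g) x = \<pi> f x + \<pi> g x) \<and>
     (\<forall>c. \<forall>f\<in>D. \<forall>x. \<pi> (act1 c f) x = fps_nth c 0 * \<pi> f x) \<and>
     (\<forall>f\<in>D. (\<forall>x. \<pi> f x = 0) \<longleftrightarrow> (\<exists>g\<in>D. f = act1 fps_X g)) \<and>
     continuous_on D (\<lambda>f x. fps_const (\<pi> f x)) \<and>
     (\<forall>f\<in>D. \<forall>g\<in>D. \<pi> (qmult H f g) = pmult P (\<pi> f) (\<pi> g)) \<and>
     \<pi> (qone H) = pone P \<and>
     (\<forall>f\<in>D. \<forall>x y. \<pi> (\<lambda>a. fps_const (\<pi> (qcoprod H f a) y)) x = pcoprod P (\<pi> f) x y) \<and>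
     (\<forall>f\<in>D. fps_nth (qcounit H f) 0 = pcounit P (\<pi> f)))"

definition quantization ::
    "('k::field, 'v::ab_group_add) qfsh \<Rightarrow> (('v \<Rightarrow> 'k fps) \<Rightarrow> 'w \<Rightarrow> 'k) \<Rightarrow>
      ('k, 'w::ab_group_add) pfsh \<Rightarrow> bool"
  where "quantization H \<pi> P \<longleftrightarrow>
    qfsh_algebra H \<and> reduction_iso H \<pi> P \<and>
    (\<forall>f\<in>dual_h (qscale H). \<forall>g\<in>dual_h (qscale H). \<exists>h\<in>dual_h (qscale H).
       (\<forall>x. qmult H f g x - qmult H g f x = fps_X * h x) \<and> \<pi> h = pbracket P (\<pi> f) (\<pi> g))"


section \<open>The trivial deformation of the invariants\<close>

text \<open>An element of \<open>A[[\<hbar>]]\<close>, for a space \<open>A\<close> of functions, is the sequence of its coefficients.\<close>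

definition series :: "('v \<Rightarrow> 'k) set \<Rightarrow> (nat \<Rightarrow> 'v \<Rightarrow> 'k) set"
  where "series A = {F. \<forall>n. F n \<in> A}"

definition series_act :: "'k::field fps \<Rightarrow> (nat \<Rightarrow> 'v \<Rightarrow> 'k) \<Rightarrow> nat \<Rightarrow> 'v \<Rightarrow> 'k"
  where "series_act c F = (\<lambda>n x. \<Sum>i\<le>n. fps_nth c i * F (n - i) x)"

definition series_mult ::
    "('k::field, 'v) pfsh \<Rightarrow> (nat \<Rightarrow> 'v \<Rightarrow> 'k) \<Rightarrow> (nat \<Rightarrow> 'v \<Rightarrow> 'k) \<Rightarrow> nat \<Rightarrow> 'v \<Rightarrow> 'k"
  where "series_mult P F G = (\<lambda>n x. \<Sum>i\<le>n. pmult P (F i) (G (n - i)) x)"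

definition series_one :: "('k::field, 'v) pfsh \<Rightarrow> nat \<Rightarrow> 'v \<Rightarrow> 'k"
  where "series_one P = (\<lambda>n x. if n = 0 then pone P x else 0)"

definition series_algebra_hom ::
    "('k::field, 'w) pfsh \<Rightarrow> ('w \<Rightarrow> 'k) set \<Rightarrow> ('k, 'v::ab_group_add) qfsh \<Rightarrow>
      ((nat \<Rightarrow> 'w \<Rightarrow> 'k) \<Rightarrow> 'v \<Rightarrow> 'k fps) \<Rightarrow> bool"
  where "series_algebra_hom P A H i \<longleftrightarrow>
    (\<forall>F\<in>series A. i F \<in> dual_h (qscale H)) \<and>
    (\<forall>F\<in>series A. \<forall>G\<in>series A. i (F + G) = i F + i G) \<and>
    (\<forall>c. \<forall>F\<in>series A. i (series_act c F) = act1 c (i F)) \<and>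
    (\<forall>F\<in>series A. \<forall>G\<in>series A. i (series_mult P F G) = qmult H (i F) (i G)) \<and>
    i (series_one P) = qone H"

end

theory Submission
  imports Defs
begin

text \<open>Conjugation by \<open>J\<close> turns \<open>U(\<gg>)[[\<hbar>]]\<close> into a Hopf algebra with coproduct
  \<open>\<Delta>\<^sub>J(x) = J \<Delta>\<^sub>0(x) J\<^sup>-\<^sup>1\<close>. The two iterated coproducts are the conjugates of \<open>(\<Delta>\<^sub>0 \<otimes> id)(\<Delta>\<^sub>0(x))\<close> by
  \<open>J\<^sup>1\<^sup>,\<^sup>2 J\<^sup>1\<^sup>2\<^sup>,\<^sup>3\<close> and by \<open>J\<^sup>2\<^sup>,\<^sup>3 J\<^sup>1\<^sup>,\<^sup>2\<^sup>3\<close>; these elements differ by the factor \<open>\<Phi>\<close>, which is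
  \<open>\<gg>\<close>-invariant, so \<open>\<Delta>\<^sub>J\<close> is coassociative even though \<open>\<Phi>\<close> need not be trivial
  (\<open>coprod_J_coassoc\<close>). The quantization is the dual \<open>U(\<gg>)\<^sup>*[[\<hbar>]]\<close>: its coproduct is dual to the
  undeformed product of \<open>U(\<gg>)\<close>, its product \<open>*\<close> is dual to the opposite of \<open>\<Delta>\<^sub>J\<close>.

  On invariant functions nothing is deformed. If \<open>f\<close> and \<open>g\<close> are invariant, then \<open>f \<otimes> g\<close> is a trace
  on \<open>U \<otimes> U\<close>, hence takes the same value on \<open>J \<Delta>\<^sub>0(x) J\<^sup>-\<^sup>1\<close> as on \<open>\<Delta>\<^sub>0(x)\<close>, so \<open>f * g\<close> is the
  original product (\<open>conv_invariant\<close>). The required embedding is therefore the plain inclusion of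
  the invariants, extended coefficientwise in \<open>\<hbar>\<close>.

  Two points of the quantization need an argument. First, modulo \<open>\<hbar>\<^sup>2\<close> the coproduct \<open>\<Delta>\<^sub>J\<close> minus its
  opposite is \<open>\<hbar> [r, \<Delta>\<^sub>0(x)]\<close>, whereas the co-Poisson map is \<open>[\<Delta>\<^sub>0(x), r]\<close>; this sign is what forces the
  opposite in the definition of the product (\<open>quantization_quantized\<close>). Second, an antipode: the
  identity of \<open>U(\<gg>)\<close> is invertible for convolution modulo \<open>\<hbar>\<close>, the inverse there being the antipode of
  \<open>U(\<gg>)\<close>, and an inverse modulo \<open>\<hbar>\<close> lifts through all orders (\<open>twisted_antipode_exists\<close>).

  Identities between expressions in power series over \<open>U\<close> or \<open>U \<otimes> U\<close> are all proved alike: both sides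
  are \<open>K[[\<hbar>]]\<close>-linear in each power series, so it suffices to compare them on constant series, and there
  on pure tensors (\<open>klin_eqI\<close>, \<open>klin_ten_eqI\<close>).\<close>

section \<open>Linear maps out of presented vector spaces\<close>

lemma linearD:
  assumes "Vector_Spaces.linear s s' h"
  shows "h (x + y) = h x + h y" "h (x - y) = h x - h y" "h (- x) = - h x" "h 0 = 0"
    "h (s c x) = s' c (h x)" "h (sum g S) = (\<Sum>i\<in>S. h (g i))"
proof -
  interpret Vector_Spaces.linear s s' h by fact
  show "h (x + y) = h x + h y" "h (x - y) = h x - h y" "h (- x) = - h x" "h 0 = 0"
    "h (s c x) = s' c (h x)" "h (sum g S) = (\<Sum>i\<in>S. h (g i))"
    by (simp_all add: add scale diff neg zero sum)
qed

lemma linear_vector_space: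
  assumes "Vector_Spaces.linear s s' h"
  shows "vector_space s" "vector_space s'"
  using assms by (simp_all add: Vector_Spaces.linear_iff)

lemma linear_comp:
  assumes "Vector_Spaces.linear s1 s2 f" "Vector_Spaces.linear s2 s3 g"
  shows "Vector_Spaces.linear s1 s3 (\<lambda>x. g (f x))"
  using assms by (simp add: Vector_Spaces.linear_iff)

lemma linear_identity:
  assumes "vector_space s"
  shows "Vector_Spaces.linear s s (\<lambda>x. x)"
  using assms by (simp add: Vector_Spaces.linear_iff)

lemma linear_zero:
  assumes "vector_space s" "vector_space s'"
  shows "Vector_Spaces.linear s s' (\<lambda>x. 0)"
  using assms by (simp add: Vector_Spaces.linear_iff module.scale_zero_right module_iff_vector_space)

lemma linear_add:
  assumes "Vector_Spaces.linear s s' f" "Vector_Spaces.linear s s' g"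
  shows "Vector_Spaces.linear s s' (\<lambda>x. f x + g x)"
  using assms by (simp add: Vector_Spaces.linear_iff module.scale_right_distrib module_iff_vector_space)

lemma linear_diff:
  assumes "Vector_Spaces.linear s s' f" "Vector_Spaces.linear s s' g"
  shows "Vector_Spaces.linear s s' (\<lambda>x. f x - g x)"
  using assms
  by (simp add: Vector_Spaces.linear_iff module.scale_right_diff_distrib module_iff_vector_space)

lemma linear_uminus:
  assumes "Vector_Spaces.linear s s' f"
  shows "Vector_Spaces.linear s s' (\<lambda>x. - f x)"
  using assms
  by (simp add: Vector_Spaces.linear_iff module.scale_minus_right module_iff_vector_space)

lemma linear_sum:
  assumes "vector_space s" "vector_space s'" "\<And>i. i \<in> S \<Longrightarrow> Vector_Spaces.linear s s' (f i)"
  shows "Vector_Spaces.linear s s' (\<lambda>x. \<Sum>i\<in>S. f i x)"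
  using assms(3)
proof (induction S rule: infinite_finite_induct)
  case (insert i S)
  then show ?case by (simp add: linear_add)
qed (simp_all add: linear_zero assms(1,2))

lemma vector_space_field: "vector_space ((*) :: 'k::field \<Rightarrow> 'k \<Rightarrow> 'k)"
  by unfold_locales (simp_all add: algebra_simps)

lemma lookup_free_scale [simp]: "Poly_Mapping.lookup (free_scale c p) x = c * Poly_Mapping.lookup p x"
  by (simp add: free_scale_def Poly_Mapping.map.rep_eq when_def)

lemma vector_space_free_scale: "vector_space free_scale"
  by unfold_locales (auto intro!: poly_mapping_eqI simp: lookup_add algebra_simps)

lemma lin_ext_eq_sum:
  assumes "vector_space s" "finite S" "Poly_Mapping.keys p \<subseteq> S"
  shows "lin_ext s e p = (\<Sum>x\<in>S. s (Poly_Mapping.lookup p x) (e x))"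
proof -
  interpret vector_space s by fact
  show ?thesis unfolding lin_ext_def
    by (rule sum.mono_neutral_left) (use assms in \<open>auto simp: in_keys_iff\<close>)
qed

lemma linear_lin_ext:
  assumes "vector_space s"
  shows "Vector_Spaces.linear free_scale s (lin_ext s e)"
proof -
  interpret vector_space s by fact
  have "lin_ext s e (p + q) = lin_ext s e p + lin_ext s e q" for p q
  proof -
    let ?S = "Poly_Mapping.keys p \<union> Poly_Mapping.keys q"
    have "Poly_Mapping.keys (p + q) \<subseteq> ?S" by (rule Poly_Mapping.keys_add)
    then show ?thesis
      by (simp add: lin_ext_eq_sum[OF assms, of ?S] lookup_add scale_left_distrib sum.distrib)
  qed
  moreover have "lin_ext s e (free_scale c p) = s c (lin_ext s e p)" for c p
  proof -
    have "Poly_Mapping.keys (free_scale c p) \<subseteq> Poly_Mapping.keys p" by (auto simp: in_keys_iff)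
    then show ?thesis
      by (simp add: lin_ext_eq_sum[OF assms, of "Poly_Mapping.keys p"] scale_sum_right)
  qed
  ultimately show ?thesis
    by (simp add: Vector_Spaces.linear_iff assms vector_space_free_scale)
qed

lemma lin_ext_single:
  assumes "vector_space s"
  shows "lin_ext s e (Poly_Mapping.single x c) = s c (e x)"
  by (subst lin_ext_eq_sum[OF assms, of "{x}"]) auto

lemma presented_by_eqI:
  assumes "presented_by s e R" "Vector_Spaces.linear s s' h" "Vector_Spaces.linear s s' h'"
    and "\<And>x. h (e x) = h' (e x)"
  shows "h w = h' w"
proof -
  from assms(1) obtain p where "w = lin_ext s e p"
    unfolding presented_by_def by (metis surjD)
  then show ?thesis
    by (simp add: lin_ext_def linearD[OF assms(2)] linearD[OF assms(3)] assms(4))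
qed

text \<open>The kernel of the presentation is the span of the relations, so a family that satisfies the
  relations extends from the generators. The universal properties of tensor products and of the
  enveloping algebra both come from this.\<close>

lemma presented_by_lift:
  assumes pres: "presented_by s e R" and vs': "vector_space s'"
    and rel: "\<And>p. p \<in> R \<Longrightarrow> lin_ext s' f p = 0"
  shows "\<exists>!h. Vector_Spaces.linear s s' h \<and> (\<forall>x. h (e x) = f x)"
proof -
  have vs: "vector_space s" and surj: "surj (lin_ext s e)"
    and ker: "{p. lin_ext s e p = 0} = module.span free_scale R"
    using pres by (simp_all add: presented_by_def)
  interpret free: vector_space "free_scale :: 'a \<Rightarrow> ('c, 'a) poly_mapping \<Rightarrow> _"
    by (rule vector_space_free_scale)
  note L = linearD[OF linear_lin_ext[OF vs, of e]]
  note L' = linearD[OF linear_lin_ext[OF vs', of f]]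
  have "free.span R \<subseteq> {p. lin_ext s' f p = 0}"
    by (rule free.span_minimal)
      (use rel in \<open>auto simp: free.subspace_def L' module.scale_zero_right[OF vs'[folded module_iff_vector_space]]\<close>)
  then have kernel: "lin_ext s' f p = 0" if "lin_ext s e p = 0" for p
    using ker that by blast
  then have well_defined: "lin_ext s' f p = lin_ext s' f q" if "lin_ext s e p = lin_ext s e q" for p q
    using kernel[of "p - q"] that by (simp add: L L')
  define h where "h w = lin_ext s' f (inv (lin_ext s e) w)" for w
  have h: "h (lin_ext s e p) = lin_ext s' f p" for p
    unfolding h_def by (rule well_defined) (simp add: surj_f_inv_f[OF surj])
  have "Vector_Spaces.linear s s' h"
    unfolding Vector_Spaces.linear_iff
  proof (intro conjI allI)
    fix x y c
    obtain p q where pq: "x = lin_ext s e p" "y = lin_ext s e q" using surj by (metis surjD)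
    show "h (x + y) = h x + h y" unfolding pq L(1)[symmetric] h by (rule L')
    show "h (s c x) = s' c (h x)" unfolding pq L(5)[symmetric] h by (rule L')
  qed (use vs vs' in auto)
  moreover have "h (e x) = f x" for x
    using h[of "Poly_Mapping.single x 1"] vs vs'
    by (simp add: lin_ext_single vector_space.vector_space_assms(4)[OF vs]
        vector_space.vector_space_assms(4)[OF vs'])
  ultimately show ?thesis
  proof (intro ex1I[of _ h] conjI allI)
    fix h' assume h': "Vector_Spaces.linear s s' h' \<and> (\<forall>x. h' (e x) = f x)"
    then show "h' = h"
      using \<open>Vector_Spaces.linear s s' h\<close> \<open>\<And>x. h (e x) = f x\<close>
      by (intro ext) (rule presented_by_eqI[OF pres, of s' h' h], simp_all)
  qed
qed


section \<open>Tensor products\<close>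

definition bilinear_map ::
    "('k::field \<Rightarrow> 'a::ab_group_add \<Rightarrow> 'a) \<Rightarrow> ('k \<Rightarrow> 'b::ab_group_add \<Rightarrow> 'b) \<Rightarrow>
      ('k \<Rightarrow> 'c::ab_group_add \<Rightarrow> 'c) \<Rightarrow> ('a \<Rightarrow> 'b \<Rightarrow> 'c) \<Rightarrow> bool"
  where "bilinear_map s1 s2 s f \<longleftrightarrow>
    (\<forall>x. Vector_Spaces.linear s2 s (f x)) \<and> (\<forall>y. Vector_Spaces.linear s1 s (\<lambda>x. f x y))"

definition tensor_lift ::
    "('k::field \<Rightarrow> 't::ab_group_add \<Rightarrow> 't) \<Rightarrow> ('a \<Rightarrow> 'b \<Rightarrow> 't) \<Rightarrow> ('k \<Rightarrow> 'w::ab_group_add \<Rightarrow> 'w) \<Rightarrow>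
      ('a \<Rightarrow> 'b \<Rightarrow> 'w) \<Rightarrow> 't \<Rightarrow> 'w"
  where "tensor_lift st t s f =
    (THE h. Vector_Spaces.linear st s h \<and> (\<forall>x y. h (t x y) = f x y))"

lemma bilinear_mapI:
  assumes "\<And>x. Vector_Spaces.linear s2 s (f x)" "\<And>y. Vector_Spaces.linear s1 s (\<lambda>x. f x y)"
  shows "bilinear_map s1 s2 s f"
  using assms by (simp add: bilinear_map_def)

lemma bilinear_mapD:
  assumes "bilinear_map s1 s2 s f"
  shows "Vector_Spaces.linear s2 s (f x)" "Vector_Spaces.linear s1 s (\<lambda>x. f x y)"
  using assms by (simp_all add: bilinear_map_def)

locale tensor_product =
  fixes s1 :: "'k::field \<Rightarrow> 'a::ring_1 \<Rightarrow> 'a" and s2 :: "'k \<Rightarrow> 'b::ring_1 \<Rightarrow> 'b"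
    and st :: "'k \<Rightarrow> 't::ring_1 \<Rightarrow> 't" and t :: "'a \<Rightarrow> 'b \<Rightarrow> 't"
  assumes tensor: "tensor_product_algebra s1 s2 st t"
    and factors: "vector_space s1" "vector_space s2"
begin

lemma presented: "presented_by st (\<lambda>(x, y). t x y) (tensor_rels s1 s2)"
  and algebra: "algebra_over st"
  and t_one: "t 1 1 = 1"
  and t_mult: "t x y * t x' y' = t (x * x') (y * y')"
  using tensor by (simp_all add: tensor_product_algebra_def)

lemma vs: "vector_space st"
  using algebra by (simp add: algebra_over_def)

lemma tensor_eqI:
  assumes "Vector_Spaces.linear st s h" "Vector_Spaces.linear st s h'"
    and "\<And>x y. h (t x y) = h' (t x y)"
  shows "h w = h' w"
  by (rule presented_by_eqI[OF presented assms(1,2)]) (auto simp: assms(3))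

lemma bilinear_t: "bilinear_map s1 s2 st t"
proof -
  interpret free: vector_space "free_scale :: 'k \<Rightarrow> ('a \<times> 'b, 'k) poly_mapping \<Rightarrow> _"
    by (rule vector_space_free_scale)
  have zero: "lin_ext st (\<lambda>(x, y). t x y) p = 0" if "p \<in> tensor_rels s1 s2" for p
    using presented free.span_base[OF that] unfolding presented_by_def by blast
  note L = linearD[OF linear_lin_ext[OF vs]] lin_ext_single[OF vs] vector_space.vector_space_assms(4)[OF vs]
  have "t (x + x') y = t x y + t x' y" "t x (y + y') = t x y + t x y'"
    "t (s1 c x) y = st c (t x y)" "t x (s2 c y) = st c (t x y)" for x x' y y' c
  proof -
    have "Poly_Mapping.single (x + x', y) 1 - Poly_Mapping.single (x, y) 1 -
        Poly_Mapping.single (x', y) 1 \<in> tensor_rels s1 s2"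
      unfolding tensor_rels_def by blast
    from zero[OF this] show "t (x + x') y = t x y + t x' y" by (simp add: L algebra_simps)
    have "Poly_Mapping.single (x, y + y') 1 - Poly_Mapping.single (x, y) 1 -
        Poly_Mapping.single (x, y') 1 \<in> tensor_rels s1 s2"
      unfolding tensor_rels_def by blast
    from zero[OF this] show "t x (y + y') = t x y + t x y'" by (simp add: L algebra_simps)
    have "Poly_Mapping.single (s1 c x, y) 1 - Poly_Mapping.single (x, y) c \<in> tensor_rels s1 s2"
      unfolding tensor_rels_def by blast
    from zero[OF this] show "t (s1 c x) y = st c (t x y)" by (simp add: L)
    have "Poly_Mapping.single (x, s2 c y) 1 - Poly_Mapping.single (x, y) c \<in> tensor_rels s1 s2"
      unfolding tensor_rels_def by blast
    from zero[OF this] show "t x (s2 c y) = st c (t x y)" by (simp add: L)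
  qed
  then show ?thesis
    by (simp add: bilinear_map_def Vector_Spaces.linear_iff vs factors)
qed

lemmas linear_t = bilinear_mapD[OF bilinear_t]

lemma tensor_lift_unique:
  assumes f: "bilinear_map s1 s2 s f"
  shows "\<exists>!h. Vector_Spaces.linear st s h \<and> (\<forall>x y. h (t x y) = f x y)"
proof -
  note F = linearD[OF bilinear_mapD(1)[OF f]] linearD[OF bilinear_mapD(2)[OF f]]
  have vs': "vector_space s" using bilinear_mapD(1)[OF f] by (rule linear_vector_space)
  have zero: "lin_ext s (\<lambda>(x, y). f x y) p = 0" if "p \<in> tensor_rels s1 s2" for p
    using that unfolding tensor_rels_def
    by (auto simp: linearD[OF linear_lin_ext[OF vs']] lin_ext_single[OF vs'] F
        vector_space.vector_space_assms(4)[OF vs'])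
  from presented_by_lift[OF presented vs' this] show ?thesis by auto
qed

lemma
  assumes "bilinear_map s1 s2 s f"
  shows linear_tensor_lift: "Vector_Spaces.linear st s (tensor_lift st t s f)"
    and tensor_lift_t: "tensor_lift st t s f (t x y) = f x y"
  using theI'[OF tensor_lift_unique[OF assms]] unfolding tensor_lift_def by blast+

lemma tensor_lift_eq:
  assumes "Vector_Spaces.linear st s h" "\<And>x y. h (t x y) = f x y"
  shows "tensor_lift st t s f = h"
proof
  have f: "bilinear_map s1 s2 s f"
    using linear_comp[OF linear_t(1) assms(1)] linear_comp[OF linear_t(2) assms(1)]
    by (simp add: bilinear_map_def assms(2))
  show "tensor_lift st t s f w = h w" for w
    by (rule tensor_eqI[OF linear_tensor_lift[OF f] assms(1)]) (simp add: tensor_lift_t[OF f] assms(2))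
qed

end


section \<open>Maps of formal power series that are linear over the power series ring\<close>

text \<open>With this notion, an identity between two expressions in a power series \<open>F\<close> need be checked
  only for constant \<open>F\<close> (\<open>klin_eqI\<close>).\<close>

definition klin ::
    "('k \<Rightarrow> 'a::ring_1 \<Rightarrow> 'a) \<Rightarrow> ('k \<Rightarrow> 'b::ring_1 \<Rightarrow> 'b) \<Rightarrow> ('a fps \<Rightarrow> 'b fps) \<Rightarrow> bool"
  where "klin s s' P \<longleftrightarrow> (\<forall>F G. P (F + G) = P F + P G) \<and> (\<forall>F. P (fps_X * F) = fps_X * P F) \<and>
    (\<forall>c F. P (fps_map (s c) F) = fps_map (s' c) (P F))"

text \<open>The \<open>K[[\<hbar>]]\<close>-linear extension of \<open>T\<close> from constants to power series.\<close>

definition fps_extend :: "('a::ring_1 \<Rightarrow> 'b::ring_1 fps) \<Rightarrow> 'a fps \<Rightarrow> 'b fps"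
  where "fps_extend T F = Abs_fps (\<lambda>n. \<Sum>i\<le>n. fps_nth (T (fps_nth F i)) (n - i))"

abbreviation fscale :: "('k \<Rightarrow> 'a \<Rightarrow> 'a) \<Rightarrow> 'k \<Rightarrow> 'a fps \<Rightarrow> 'a fps"
  where "fscale s c \<equiv> fps_map (s c)"

lemma fps_nth_fps_map [simp]: "fps_nth (fps_map h F) n = h (fps_nth F n)"
  by (simp add: fps_map_def)

lemma fps_map_const: "h 0 = 0 \<Longrightarrow> fps_map h (fps_const a) = fps_const (h a)"
  by (rule fps_ext) simp

lemma fscale_field: "fscale (*) = (\<lambda>c p. fps_const c * (p :: 'k::field fps))"
  by (intro ext fps_ext) simp

lemma vector_space_fscale:
  assumes "vector_space s"
  shows "vector_space (fscale s)"
proof -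
  interpret vector_space s by fact
  show ?thesis
    by unfold_locales (simp_all add: fps_eq_iff scale_right_distrib scale_left_distrib)
qed

lemma klin_decompose:
  assumes "klin s s' P"
  shows "P F = P (fps_const (fps_nth F 0)) + fps_X * P (fps_shift 1 F)"
proof -
  have "F = fps_const (fps_nth F 0) + fps_X * fps_shift 1 F"
    by (rule fps_ext) simp
  then have "P F = P (fps_const (fps_nth F 0) + fps_X * fps_shift 1 F)"
    by (rule arg_cong)
  then show ?thesis using assms by (simp add: klin_def)
qed

text \<open>Writing \<open>F = F\<^sub>0 + \<hbar> F'\<close>, the coefficient of \<open>\<hbar>\<^sup>n\<close> of \<open>P F\<close> is determined by the values of \<open>P\<close> on
  constants and by the coefficient of \<open>\<hbar>\<^sup>n\<^sup>-\<^sup>1\<close> of \<open>P F'\<close>.\<close>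

lemma klin_eqI:
  assumes P: "klin s s' P" and Q: "klin s s' Q"
    and const: "\<And>a. P (fps_const a) = Q (fps_const a)"
  shows "P F = Q F"
proof (rule fps_ext)
  show "fps_nth (P F) n = fps_nth (Q F) n" for n
  proof (induction n arbitrary: F)
    case (0 F)
    show ?case
      by (subst klin_decompose[OF P], subst klin_decompose[OF Q]) (simp add: const)
  next
    case (Suc n F)
    show ?case
      by (subst klin_decompose[OF P], subst klin_decompose[OF Q]) (simp add: const Suc)
  qed
qed

lemma fps_extend_const: "T 0 = 0 \<Longrightarrow> fps_extend T (fps_const a) = T a"
  by (rule fps_ext) (simp add: fps_extend_def if_distrib[of T] if_distrib[of "\<lambda>F. fps_nth F _"] cong: if_cong)

lemma klin_fps_extend:
  assumes "Vector_Spaces.linear s (fscale s') T"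
  shows "klin s s' (fps_extend T)"
  unfolding klin_def
proof (intro conjI allI)
  note T = linearD[OF assms]
  interpret s': vector_space "fscale s'" using assms by (rule linear_vector_space)
  have s'_sum: "s' c (sum g S) = (\<Sum>i\<in>S. s' c (g i))" for c g and S :: "nat set"
  proof -
    have "fps_nth (fscale s' c (\<Sum>i\<in>S. fps_const (g i))) 0 = fps_nth (\<Sum>i\<in>S. fscale s' c (fps_const (g i))) 0"
      by (simp only: s'.scale_sum_right)
    then show ?thesis by (simp add: fps_sum_nth)
  qed
  fix F G c
  show "fps_extend T (F + G) = fps_extend T F + fps_extend T G"
    by (rule fps_ext) (simp add: fps_extend_def T sum.distrib)
  show "fps_extend T (fps_X * F) = fps_X * fps_extend T F"
  proof (rule fps_ext)
    fix n
    show "fps_nth (fps_extend T (fps_X * F)) n = fps_nth (fps_X * fps_extend T F) n"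
      by (cases n) (simp_all add: fps_extend_def T sum.atMost_Suc_shift del: sum.atMost_Suc)
  qed
  show "fps_extend T (fscale s c F) = fscale s' c (fps_extend T F)"
    by (rule fps_ext) (simp add: fps_extend_def T s'_sum)
qed

lemma klin_comp:
  assumes "klin s1 s2 P" "klin s2 s3 Q"
  shows "klin s1 s3 (\<lambda>F. Q (P F))"
  using assms by (simp add: klin_def)

lemma klin_ident: "klin s s (\<lambda>F. F)"
  by (simp add: klin_def)

lemma klin_fps_map:
  assumes "Vector_Spaces.linear s s' h"
  shows "klin s s' (fps_map h)"
  by (auto simp: klin_def linearD[OF assms] fps_eq_iff)

lemma klin_mult_left:
  assumes "algebra_over s" "klin s' s P"
  shows "klin s' s (\<lambda>F. A * P F)"
proof -
  interpret vector_space s using assms(1) by (simp add: algebra_over_def)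
  have "A * fscale s c F = fscale s c (A * F)" for c F
    using assms(1) by (simp add: fps_eq_iff fps_mult_nth scale_sum_right algebra_over_def)
  moreover have "A * (fps_X * F) = fps_X * (A * F)" for F
    by (metis fps_mult_fps_X_commute mult.assoc)
  ultimately show ?thesis
    using assms(2) by (simp add: klin_def algebra_simps)
qed

lemma klin_mult_right:
  assumes "algebra_over s" "klin s' s P"
  shows "klin s' s (\<lambda>F. P F * A)"
proof -
  interpret vector_space s using assms(1) by (simp add: algebra_over_def)
  have "fscale s c F * A = fscale s c (F * A)" for c F
    using assms(1) by (simp add: fps_eq_iff fps_mult_nth scale_sum_right algebra_over_def)
  then show ?thesis
    using assms(2) by (simp add: klin_def algebra_simps)
qed

lemma linear_fps_const:
  assumes "vector_space s"
  shows "Vector_Spaces.linear s (fscale s) fps_const"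
proof -
  interpret vector_space s by fact
  show ?thesis
    by (auto simp: Vector_Spaces.linear_iff assms vector_space_fscale fps_eq_iff)
qed

lemma klin_linear:
  assumes "klin s s' P" "vector_space s" "vector_space s'"
  shows "Vector_Spaces.linear (fscale s) (fscale s') P"
  using assms by (simp add: klin_def Vector_Spaces.linear_iff vector_space_fscale)

lemma klin_linear_const:
  assumes "klin s s' P" "vector_space s" "vector_space s'"
  shows "Vector_Spaces.linear s (fscale s') (\<lambda>a. P (fps_const a))"
  using linear_comp[OF linear_fps_const klin_linear] assms by blast

lemma fps_map_hom:
  assumes "algebra_hom s s' h" "algebra_over s" "algebra_over s'"
  shows "fps_map h (F * G) = fps_map h F * fps_map h G" "fps_map h 1 = 1"
proof -
  have h: "Vector_Spaces.linear s s' h" using assms(1) by (simp add: algebra_hom_def)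
  show "fps_map h (F * G) = fps_map h F * fps_map h G"
    using assms(1) by (simp add: fps_eq_iff fps_mult_nth linearD[OF h] algebra_hom_def)
  show "fps_map h 1 = 1"
    using assms(1) by (simp add: fps_eq_iff linearD[OF h] algebra_hom_def)
qed


section \<open>The Hopf algebra structure of the enveloping algebra\<close>

lemma algebra_homD:
  assumes "algebra_hom s s' h"
  shows "Vector_Spaces.linear s s' h" "h 1 = 1" "h (x * y) = h x * h y"
  using assms by (simp_all add: algebra_hom_def)

lemma algebra_hom_comp:
  assumes "algebra_hom s1 s2 f" "algebra_hom s2 s3 g"
  shows "algebra_hom s1 s3 (\<lambda>x. g (f x))"
  using assms linear_comp by (auto simp: algebra_hom_def)

lemma algebra_over_vector_space: "algebra_over s \<Longrightarrow> vector_space s"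
  by (simp add: algebra_over_def)

lemma algebra_over_scale:
  assumes "algebra_over s"
  shows "s c x * y = s c (x * y)" "x * s c y = s c (x * y)"
  using assms by (simp_all add: algebra_over_def)

lemma algebra_over_field: "algebra_over ((*) :: 'k::field \<Rightarrow> 'k \<Rightarrow> 'k)"
  by (simp add: algebra_over_def vector_space_field)

lemma linear_mult:
  assumes "algebra_over s" "Vector_Spaces.linear s' s f"
  shows "Vector_Spaces.linear s' s (\<lambda>x. a * f x)" "Vector_Spaces.linear s' s (\<lambda>x. f x * a)"
  using assms by (auto simp: Vector_Spaces.linear_iff algebra_over_scale algebra_simps)

lemma (in tensor_product) algebra_hom_tensor_lift:
  assumes f: "bilinear_map s1 s2 s f" and s: "algebra_over s"
    and one: "f 1 1 = 1" and mult: "\<And>x y x' y'. f (x * x') (y * y') = f x y * f x' y'"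
  shows "algebra_hom st s (tensor_lift st t s f)"
proof -
  let ?h = "tensor_lift st t s f"
  note L = linear_tensor_lift[OF f]
  have *: "?h (w * t x y) = ?h w * ?h (t x y)" for w x y
    by (rule tensor_eqI[where h = "\<lambda>w. ?h (w * t x y)" and s = s])
      (simp_all add: t_mult tensor_lift_t[OF f] mult
        linear_comp[OF linear_mult(2)[OF algebra linear_identity[OF vs]] L] linear_mult[OF s L])
  have "?h (w * w') = ?h w * ?h w'" for w w'
    by (rule tensor_eqI[where h = "\<lambda>w'. ?h (w * w')" and s = s])
      (simp_all add: * linear_comp[OF linear_mult(1)[OF algebra linear_identity[OF vs]] L]
        linear_mult[OF s L])
  moreover have "?h 1 = 1"
    using tensor_lift_t[OF f, of 1 1] by (simp add: t_one one)
  ultimately show ?thesis by (simp add: algebra_hom_def L)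
qed

lemma lin_ext_enveloping_rels:
  assumes vs: "vector_space s"
    and add: "\<And>u x y v. f (u @ [x + y] @ v) = f (u @ [x] @ v) + f (u @ [y] @ v)"
    and scale: "\<And>u c x v. f (u @ [sg c x] @ v) = s c (f (u @ [x] @ v))"
    and bracket: "\<And>u x y v. f (u @ [x, y] @ v) - f (u @ [y, x] @ v) = f (u @ [br x y] @ v)"
    and p: "p \<in> enveloping_rels sg br"
  shows "lin_ext s f p = 0"
proof -
  note L = linearD(2)[OF linear_lin_ext[OF vs]] lin_ext_single[OF vs]
    vector_space.vector_space_assms(4)[OF vs]
  show ?thesis
    using p unfolding enveloping_rels_def
    by (elim UnE CollectE exE conjE) (simp_all only: L add scale bracket, simp_all)
qed

locale enveloping =
  fixes E :: "('k::field, 'g::ab_group_add, 'u::ring_1, 'uu::ring_1, 'uuu::ring_1) env"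
  assumes enveloping: "is_enveloping E"
begin

abbreviation "sg \<equiv> gscale E"
abbreviation "br \<equiv> gbracket E"
abbreviation "su \<equiv> uscale E"
abbreviation "j \<equiv> incl E"
abbreviation "suu \<equiv> uuscale E"
abbreviation "suuu \<equiv> uuuscale E"

lemma lie: "lie_algebra sg br"
  and env: "enveloping_algebra sg br su j"
  and tensor2: "tensor_product_algebra su su suu (ten E)"
  and tensor3: "tensor_product_algebra suu su suuu (ten21 E)"
  using enveloping by (simp_all add: is_enveloping_def)

lemma algebra_u: "algebra_over su"
  and presented_u: "presented_by su (\<lambda>w. prod_list (map j w)) (enveloping_rels sg br)"
  using env by (simp_all add: enveloping_algebra_def)

lemma algebra_uu: "algebra_over suu" and algebra_uuu: "algebra_over suuu"
  using tensor2 tensor3 by (simp_all add: tensor_product_algebra_def)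

lemmas vs_u = algebra_over_vector_space[OF algebra_u]
lemmas vs_uu = algebra_over_vector_space[OF algebra_uu]
lemmas vs_uuu = algebra_over_vector_space[OF algebra_uuu]

lemma vs_g: "vector_space sg"
  using lie by (simp add: lie_algebra_def)

sublocale UU: tensor_product su su suu "ten E"
  by (rule tensor_product.intro) (rule tensor2 vs_u)+

sublocale UUU: tensor_product suu su suuu "ten21 E"
  by (rule tensor_product.intro) (rule tensor3 vs_u vs_uu)+

lemma lift2_eq: "lift2 E s f = tensor_lift suu (ten E) s f"
  by (simp add: lift2_def tensor_lift_def)

lemmas linear_lift2 = UU.linear_tensor_lift[folded lift2_eq]
lemmas lift2_ten = UU.tensor_lift_t[folded lift2_eq]
lemmas lift2_eqI = UU.tensor_lift_eq[folded lift2_eq]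
lemmas algebra_hom_lift2 = UU.algebra_hom_tensor_lift[folded lift2_eq]

lemma incl_rels:
  "j (x + y) = j x + j y" "j (sg c x) = su c (j x)" "j (br x y) = j x * j y - j y * j x"
proof -
  interpret free: vector_space "free_scale :: 'k \<Rightarrow> ('g list, 'k) poly_mapping \<Rightarrow> _"
    by (rule vector_space_free_scale)
  let ?e = "\<lambda>w. prod_list (map j w)"
  have zero: "lin_ext su ?e p = 0" if "p \<in> enveloping_rels sg br" for p
    using presented_u free.span_base[OF that] unfolding presented_by_def by blast
  note L = linearD[OF linear_lin_ext[OF vs_u]] lin_ext_single[OF vs_u]
    vector_space.vector_space_assms(4)[OF vs_u]
  have "Poly_Mapping.single ([] @ [x + y] @ []) 1 - Poly_Mapping.single ([] @ [x] @ []) 1 -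
       Poly_Mapping.single ([] @ [y] @ []) 1 \<in> enveloping_rels sg br"
    unfolding enveloping_rels_def by blast
  from zero[OF this] show "j (x + y) = j x + j y" by (simp add: L algebra_simps)
  have "Poly_Mapping.single ([] @ [sg c x] @ []) 1 - Poly_Mapping.single ([] @ [x] @ []) c
      \<in> enveloping_rels sg br"
    unfolding enveloping_rels_def by blast
  from zero[OF this] show "j (sg c x) = su c (j x)" by (simp add: L)
  have "Poly_Mapping.single ([] @ [x, y] @ []) 1 - Poly_Mapping.single ([] @ [y, x] @ []) 1 -
       Poly_Mapping.single ([] @ [br x y] @ []) 1 \<in> enveloping_rels sg br"
    unfolding enveloping_rels_def by blast
  from zero[OF this] show "j (br x y) = j x * j y - j y * j x" by (simp add: L algebra_simps)
qed

lemma linear_incl: "Vector_Spaces.linear sg su j"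
  by (simp add: Vector_Spaces.linear_iff vs_g vs_u incl_rels)

text \<open>Induction over words, which span \<open>U\<close>, adding a letter in front or at the end.\<close>

lemma u_eqI_left:
  assumes "Vector_Spaces.linear su s h" "Vector_Spaces.linear su s h'" "h 1 = h' 1"
    and step: "\<And>x a. h a = h' a \<Longrightarrow> h (j x * a) = h' (j x * a)"
  shows "h a = h' a"
proof (rule presented_by_eqI[OF presented_u assms(1,2)])
  show "h (prod_list (map j w)) = h' (prod_list (map j w))" for w
    by (induction w) (simp_all add: assms(3) step)
qed

lemma u_eqI_right:
  assumes "Vector_Spaces.linear su s h" "Vector_Spaces.linear su s h'" "h 1 = h' 1"
    and step: "\<And>x a. h a = h' a \<Longrightarrow> h (a * j x) = h' (a * j x)"
  shows "h a = h' a"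
proof (rule presented_by_eqI[OF presented_u assms(1,2)])
  show "h (prod_list (map j w)) = h' (prod_list (map j w))" for w
    by (induction w rule: rev_induct) (simp_all add: assms(3) step)
qed

lemma hom_eqI:
  assumes "algebra_hom su s h" "algebra_hom su s h'" "\<And>x. h (j x) = h' (j x)"
  shows "h a = h' a"
  by (rule u_eqI_left[OF algebra_homD(1)[OF assms(1)] algebra_homD(1)[OF assms(2)]])
    (simp_all add: algebra_homD[OF assms(1)] algebra_homD[OF assms(2)] assms(3))

text \<open>The universal property of the enveloping algebra: on words the map is forced, it respects the
  enveloping relations, and it is multiplicative because words concatenate.\<close>

lemma hom_unique:
  assumes s: "algebra_over s" and \<phi>: "Vector_Spaces.linear sg s \<phi>"
    and bracket: "\<And>x y. \<phi> (br x y) = \<phi> x * \<phi> y - \<phi> y * \<phi> x"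
  shows "\<exists>!h. algebra_hom su s h \<and> (\<forall>x. h (j x) = \<phi> x)"
proof -
  have vs: "vector_space s" using s by (rule algebra_over_vector_space)
  have "lin_ext s (\<lambda>w. prod_list (map \<phi> w)) p = 0" if "p \<in> enveloping_rels sg br" for p
    by (rule lin_ext_enveloping_rels[OF vs _ _ _ that])
      (simp_all add: linearD[OF \<phi>] bracket algebra_over_scale[OF s] algebra_simps)
  from presented_by_lift[OF presented_u vs this] obtain h
    where h: "Vector_Spaces.linear su s h" and hw: "\<And>w. h (prod_list (map j w)) = prod_list (map \<phi> w)"
    by blast
  have word: "h (prod_list (map j w) * a) = h (prod_list (map j w)) * h a" for w a
  proof (rule presented_by_eqI[OF presented_u])
    show "Vector_Spaces.linear su s (\<lambda>a. h (prod_list (map j w) * a))"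
      by (rule linear_comp[OF linear_mult(1)[OF algebra_u linear_identity[OF vs_u]] h])
    show "Vector_Spaces.linear su s (\<lambda>a. h (prod_list (map j w)) * h a)"
      by (rule linear_mult(1)[OF s h])
    show "h (prod_list (map j w) * prod_list (map j v)) = h (prod_list (map j w)) * h (prod_list (map j v))" for v
      using hw[of "w @ v"] by (simp add: hw)
  qed
  have mult: "h (b * a) = h b * h a" for a b
  proof (rule presented_by_eqI[OF presented_u, where h = "\<lambda>b. h (b * a)" and h' = "\<lambda>b. h b * h a"])
    show "Vector_Spaces.linear su s (\<lambda>b. h (b * a))"
      by (rule linear_comp[OF linear_mult(2)[OF algebra_u linear_identity[OF vs_u]] h])
    show "Vector_Spaces.linear su s (\<lambda>b. h b * h a)"
      by (rule linear_mult(2)[OF s h])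
  qed (rule word)
  have h_hom: "algebra_hom su s h"
    using h mult hw[of "[]"] by (simp add: algebra_hom_def)
  have h_incl: "h (j x) = \<phi> x" for x
    using hw[of "[x]"] by simp
  show ?thesis
  proof (intro ex1I[of _ h] conjI allI)
    fix h' assume "algebra_hom su s h' \<and> (\<forall>x. h' (j x) = \<phi> x)"
    then show "h' = h"
      by (intro ext) (rule hom_eqI[OF _ h_hom], auto simp: h_incl)
  qed (rule h_hom h_incl)+
qed

abbreviation "\<Delta> \<equiv> coprod0 E"
abbreviation "\<epsilon> \<equiv> counit0 E"

lemma ten_simps:
  "ten E (x + x') y = ten E x y + ten E x' y" "ten E x (y + y') = ten E x y + ten E x y'"
  "ten E (x - x') y = ten E x y - ten E x' y" "ten E x (y - y') = ten E x y - ten E x y'"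
  "ten E (su c x) y = suu c (ten E x y)" "ten E x (su c y) = suu c (ten E x y)"
  by (simp_all add: linearD[OF UU.linear_t(1)] linearD[OF UU.linear_t(2)])

lemma coprod_hom: "algebra_hom su suu \<Delta>"
  and coprod_incl: "\<Delta> (j x) = prim2 E x"
proof -
  have "\<exists>!h. algebra_hom su suu h \<and> (\<forall>x. h (j x) = prim2 E x)"
  proof (rule hom_unique[OF algebra_uu])
    show "Vector_Spaces.linear sg suu (prim2 E)"
      unfolding prim2_def
      by (intro linear_add linear_comp[OF linear_incl UU.linear_t(1)]
          linear_comp[OF linear_incl UU.linear_t(2)])
    show "prim2 E (br x y) = prim2 E x * prim2 E y - prim2 E y * prim2 E x" for x y
      by (simp add: prim2_def incl_rels ten_simps UU.t_mult algebra_simps)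
  qed
  from theI'[OF this] show "algebra_hom su suu \<Delta>" "\<Delta> (j x) = prim2 E x"
    unfolding coprod0_def prim2_def by auto
qed

lemmas coprodD = linearD[OF algebra_homD(1)[OF coprod_hom]] algebra_homD(2,3)[OF coprod_hom]

lemma counit_hom: "algebra_hom su (*) \<epsilon>"
  and counit_incl: "\<epsilon> (j x) = 0"
proof -
  have "\<exists>!h. algebra_hom su (*) h \<and> (\<forall>x. h (j x) = (0::'k))"
    by (rule hom_unique[OF algebra_over_field linear_zero[OF vs_g vector_space_field]]) simp
  from theI'[OF this] show "algebra_hom su (*) \<epsilon>" "\<epsilon> (j x) = 0"
    unfolding counit0_def by auto
qed

lemmas counitD = linearD[OF algebra_homD(1)[OF counit_hom]] algebra_homD(2,3)[OF counit_hom]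

definition flip :: "'uu \<Rightarrow> 'uu"
  where "flip = lift2 E suu (\<lambda>x y. ten E y x)"

lemma bilinear_flip: "bilinear_map su su suu (\<lambda>x y. ten E y x)"
  by (rule bilinear_mapI) (rule UU.linear_t)+

lemma flip_hom: "algebra_hom suu suu flip"
  unfolding flip_def
  by (rule algebra_hom_lift2[OF bilinear_flip algebra_uu]) (simp_all add: UU.t_one UU.t_mult)

lemma flip_ten: "flip (ten E x y) = ten E y x"
  by (simp add: flip_def lift2_ten[OF bilinear_flip])

lemmas flipD = linearD[OF algebra_homD(1)[OF flip_hom]] algebra_homD(2,3)[OF flip_hom]

lemma flip_coprod: "flip (\<Delta> x) = \<Delta> x"
  by (rule hom_eqI[OF algebra_hom_comp[OF coprod_hom flip_hom] coprod_hom])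
    (simp add: coprod_incl prim2_def flipD flip_ten add.commute)

lemma alt2_eq: "alt2 E w = w - flip w"
proof -
  have "alt2 E = (\<lambda>w. w - flip w)"
    unfolding alt2_def
    by (rule lift2_eqI) (simp_all add: flip_ten linear_diff[OF linear_identity[OF vs_uu] algebra_homD(1)[OF flip_hom]])
  then show ?thesis by simp
qed

lemma lift2_flip:
  assumes "bilinear_map su su s f"
  shows "lift2 E s (\<lambda>x y. f y x) w = lift2 E s f (flip w)"
proof -
  have "lift2 E s (\<lambda>x y. f y x) = (\<lambda>w. lift2 E s f (flip w))"
    by (rule lift2_eqI)
      (simp_all add: linear_comp[OF algebra_homD(1)[OF flip_hom] linear_lift2[OF assms]]
        flip_ten lift2_ten[OF assms])
  then show ?thesis by simp
qed

text \<open>The inner derivation by \<open>r\<close> agrees with \<open>\<delta>\<close> on \<open>\<gg>\<close> and is a \<open>\<Delta>\<^sub>0\<close>-derivation, hence it is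
  the co-Poisson map.\<close>

lemma co_poisson_eq:
  assumes \<delta>: "\<And>x. \<delta> x = commutator (prim2 E x) r"
  shows "co_poisson E \<delta> a = commutator (\<Delta> a) r"
proof -
  let ?D = "\<lambda>a. commutator (\<Delta> a) r"
  have lin: "Vector_Spaces.linear su suu ?D"
    unfolding commutator_def
    by (intro linear_diff linear_mult algebra_uu algebra_homD(1)[OF coprod_hom])
  have D: "?D (j x) = \<delta> x" "?D (a * b) = ?D a * \<Delta> b + \<Delta> a * ?D b" for x a b
    by (simp_all add: \<delta> coprod_incl coprodD commutator_def algebra_simps)
  have "co_poisson E \<delta> = ?D"
    unfolding co_poisson_def
  proof (intro the_equality conjI allI lin D)
    fix D assume D': "Vector_Spaces.linear su suu D \<and> (\<forall>x. D (j x) = \<delta> x) \<and>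
       (\<forall>a b. D (a * b) = D a * \<Delta> b + \<Delta> a * D b)"
    then have "D (1 * 1) = D 1 * \<Delta> 1 + \<Delta> 1 * D 1" by blast
    then have D1: "D 1 = 0" by (simp add: coprodD)
    show "D = ?D"
    proof
      show "D a = ?D a" for a
      proof (rule u_eqI_left[where h = D and h' = ?D and s = suu])
        show "D 1 = ?D 1" by (simp add: D1 coprodD commutator_def)
        show "D (j x * a) = ?D (j x * a)" if "D a = ?D a" for x a
          using D' that by (simp only: D)
      qed (use D' lin in auto)
    qed
  qed
  then show ?thesis by simp
qed

lemma bilinear_counit:
  "bilinear_map su su su (\<lambda>x y. su (\<epsilon> x) y)" "bilinear_map su su su (\<lambda>x y. su (\<epsilon> y) x)"
proof -
  interpret vector_space su by (rule vs_u)
  have "Vector_Spaces.linear su su (su c)" for c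
    by (simp add: Vector_Spaces.linear_iff vs_u scale_right_distrib mult.commute)
  moreover have "Vector_Spaces.linear su su (\<lambda>x. su (\<epsilon> x) y)" for y
    by (simp add: Vector_Spaces.linear_iff vs_u counitD scale_left_distrib)
  ultimately show "bilinear_map su su su (\<lambda>x y. su (\<epsilon> x) y)" "bilinear_map su su su (\<lambda>x y. su (\<epsilon> y) x)"
    by (simp_all add: bilinear_map_def)
qed

definition counit_left :: "'uu \<Rightarrow> 'u" where "counit_left = lift2 E su (\<lambda>x y. su (\<epsilon> x) y)"
definition counit_right :: "'uu \<Rightarrow> 'u" where "counit_right = lift2 E su (\<lambda>x y. su (\<epsilon> y) x)"

lemma counit_left_ten: "counit_left (ten E x y) = su (\<epsilon> x) y"
  and counit_right_ten: "counit_right (ten E x y) = su (\<epsilon> y) x"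
  by (simp_all add: counit_left_def counit_right_def lift2_ten[OF bilinear_counit(1)]
      lift2_ten[OF bilinear_counit(2)])

lemma counit_left_hom: "algebra_hom suu su counit_left"
  and counit_right_hom: "algebra_hom suu su counit_right"
proof -
  interpret vector_space su by (rule vs_u)
  show "algebra_hom suu su counit_left" unfolding counit_left_def
    by (rule algebra_hom_lift2[OF bilinear_counit(1) algebra_u])
      (simp_all add: counitD algebra_over_scale[OF algebra_u] mult.commute)
  show "algebra_hom suu su counit_right" unfolding counit_right_def
    by (rule algebra_hom_lift2[OF bilinear_counit(2) algebra_u])
      (simp_all add: counitD algebra_over_scale[OF algebra_u] mult.commute)
qed

lemma counit_left_coprod: "counit_left (\<Delta> x) = x"
  and counit_right_coprod: "counit_right (\<Delta> x) = x"
proof -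
  interpret vector_space su by (rule vs_u)
  have ident: "algebra_hom su su (\<lambda>x. x)"
    by (simp add: algebra_hom_def linear_identity[OF vs_u])
  show "counit_left (\<Delta> x) = x"
    by (rule hom_eqI[OF algebra_hom_comp[OF coprod_hom counit_left_hom] ident])
      (simp add: coprod_incl prim2_def linearD[OF algebra_homD(1)[OF counit_left_hom]]
        counit_left_ten counit_incl counitD)
  show "counit_right (\<Delta> x) = x"
    by (rule hom_eqI[OF algebra_hom_comp[OF coprod_hom counit_right_hom] ident])
      (simp add: coprod_incl prim2_def linearD[OF algebra_homD(1)[OF counit_right_hom]]
        counit_right_ten counit_incl counitD)
qed

subsection \<open>Leg notation\<close>

lemma ten21_simps:
  "ten21 E (x + x') y = ten21 E x y + ten21 E x' y" "ten21 E x (y + y') = ten21 E x y + ten21 E x y'"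
  "ten21 E (sum f S) y = (\<Sum>i\<in>S. ten21 E (f i) y)"
  "ten21 E (suu c x) y = suuu c (ten21 E x y)" "ten21 E x (su c y) = suuu c (ten21 E x y)"
  "ten21 E 0 y = 0"
  by (simp_all add: linearD[OF UUU.linear_t(1)] linearD[OF UUU.linear_t(2)])

lemma ten3_mult: "ten3 E x y z * ten3 E x' y' z' = ten3 E (x * x') (y * y') (z * z')"
  by (simp add: ten3_def UUU.t_mult UU.t_mult)

lemma leg12_hom: "algebra_hom suu suuu (leg12 E)"
  unfolding algebra_hom_def leg12_def
  by (simp add: UUU.linear_t(2) UUU.t_one UUU.t_mult)

lemma bilinear_leg23: "bilinear_map su su suuu (\<lambda>x y. ten3 E 1 x y)"
  unfolding ten3_def
  by (rule bilinear_mapI) (rule UUU.linear_t linear_comp[OF UU.linear_t(1) UUU.linear_t(2)])+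

lemma leg23_hom: "algebra_hom suu suuu (leg23 E)"
  unfolding leg23_def
  by (rule algebra_hom_lift2[OF bilinear_leg23 algebra_uuu])
    (simp_all add: ten3_mult, simp add: ten3_def UU.t_one UUU.t_one)

lemma leg23_ten: "leg23 E (ten E x y) = ten3 E 1 x y"
  by (simp add: leg23_def lift2_ten[OF bilinear_leg23])

lemmas leg23D = linearD[OF algebra_homD(1)[OF leg23_hom]] algebra_homD(2,3)[OF leg23_hom]

lemma bilinear_leg12_3: "bilinear_map su su suuu (\<lambda>x y. ten21 E (\<Delta> x) y)"
  by (rule bilinear_mapI)
    (rule UUU.linear_t linear_comp[OF algebra_homD(1)[OF coprod_hom] UUU.linear_t(2)])+

lemma leg12_3_hom: "algebra_hom suu suuu (leg12_3 E)"
  unfolding leg12_3_def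
  by (rule algebra_hom_lift2[OF bilinear_leg12_3 algebra_uuu])
    (simp_all add: coprodD UUU.t_mult UUU.t_one)

lemma leg12_3_ten: "leg12_3 E (ten E x y) = ten21 E (\<Delta> x) y"
  by (simp add: leg12_3_def lift2_ten[OF bilinear_leg12_3])

lemma leg23_commute: "ten3 E x 1 1 * leg23 E w = leg23 E w * ten3 E x 1 1"
  by (rule UU.tensor_eqI[where h = "\<lambda>w. ten3 E x 1 1 * leg23 E w" and s = suuu])
    (simp_all add: leg23_ten ten3_mult linear_mult[OF algebra_uuu algebra_homD(1)[OF leg23_hom]])

lemma lift2_ten3: "lift2 E suuu (\<lambda>y y'. ten3 E x y y') w = ten3 E x 1 1 * leg23 E w"
proof -
  have "lift2 E suuu (\<lambda>y y'. ten3 E x y y') = (\<lambda>w. ten3 E x 1 1 * leg23 E w)"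
    by (rule lift2_eqI)
      (simp_all add: leg23_ten ten3_mult linear_mult[OF algebra_uuu algebra_homD(1)[OF leg23_hom]])
  then show ?thesis by simp
qed

lemma linear_ten3: "Vector_Spaces.linear su suuu (\<lambda>x. ten3 E x y z)"
  unfolding ten3_def by (rule linear_comp[OF UU.linear_t(2) UUU.linear_t(2)])

lemma bilinear_leg1_23: "bilinear_map su su suuu (\<lambda>x y. ten3 E x 1 1 * leg23 E (\<Delta> y))"
  by (rule bilinear_mapI)
    (rule linear_mult[OF algebra_uuu] linear_ten3
      linear_comp[OF algebra_homD(1)[OF coprod_hom] algebra_homD(1)[OF leg23_hom]])+

lemma leg1_23_eq: "leg1_23 E = lift2 E suuu (\<lambda>x y. ten3 E x 1 1 * leg23 E (\<Delta> y))"
  by (simp add: leg1_23_def lift2_ten3)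

lemma leg1_23_ten: "leg1_23 E (ten E x y) = ten3 E x 1 1 * leg23 E (\<Delta> y)"
  by (simp add: leg1_23_eq lift2_ten[OF bilinear_leg1_23])

text \<open>The image of \<open>x \<otimes> y\<close> is the product of \<open>x \<otimes> 1 \<otimes> 1\<close> and \<open>1 \<otimes> \<Delta>\<^sub>0(y)\<close>; multiplicativity holds
  because such factors commute.\<close>

lemma leg1_23_hom: "algebra_hom suu suuu (leg1_23 E)"
  unfolding leg1_23_eq
proof (rule algebra_hom_lift2[OF bilinear_leg1_23 algebra_uuu])
  show "ten3 E 1 1 1 * leg23 E (\<Delta> 1) = 1"
    by (simp add: leg23D coprodD ten3_def UU.t_one UUU.t_one)
  fix x y x' y'
  have "ten3 E (x * x') 1 1 * leg23 E (\<Delta> (y * y')) =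
      ten3 E x 1 1 * (ten3 E x' 1 1 * leg23 E (\<Delta> y)) * leg23 E (\<Delta> y')"
    by (simp add: ten3_mult leg23D coprodD mult.assoc[symmetric])
  also have "\<dots> = ten3 E x 1 1 * leg23 E (\<Delta> y) * (ten3 E x' 1 1 * leg23 E (\<Delta> y'))"
    by (simp only: leg23_commute[of x'] mult.assoc)
  finally show "ten3 E (x * x') 1 1 * leg23 E (\<Delta> (y * y')) =
      ten3 E x 1 1 * leg23 E (\<Delta> y) * (ten3 E x' 1 1 * leg23 E (\<Delta> y'))" .
qed

definition coprod3 :: "'u \<Rightarrow> 'uuu"
  where "coprod3 x = leg12_3 E (\<Delta> x)"

lemma coprod3_hom: "algebra_hom su suuu coprod3"
  unfolding coprod3_def by (rule algebra_hom_comp[OF coprod_hom leg12_3_hom])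

lemma coprod3_incl: "coprod3 (j x) = prim3 E x"
  by (simp add: coprod3_def coprod_incl prim2_def linearD[OF algebra_homD(1)[OF leg12_3_hom]]
      leg12_3_ten coprodD ten21_simps prim3_def ten3_def UU.t_one)

lemma coprod_coassoc: "leg1_23 E (\<Delta> x) = coprod3 x"
  by (rule hom_eqI[OF algebra_hom_comp[OF coprod_hom leg1_23_hom] coprod3_hom])
    (simp add: coprod3_incl coprod_incl prim2_def linearD[OF algebra_homD(1)[OF leg1_23_hom]]
      leg1_23_ten coprodD leg23D leg23_ten ten3_mult prim3_def distrib_left)

subsection \<open>The antipode of the enveloping algebra\<close>

text \<open>On words the antipode reverses the order and changes the sign of every letter. The sign and the
  reversal together preserve the relation \<open>[x, y] = xy - yx\<close>.\<close>

lemma antipode_exists: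
  "\<exists>S. Vector_Spaces.linear su su S \<and> S 1 = 1 \<and> (\<forall>x. S (j x) = - j x) \<and> (\<forall>a b. S (a * b) = S b * S a)"
proof -
  have scale_minus: "su c (- x) = - su c x" for c x
    by (rule module.scale_minus_right[OF vs_u[folded module_iff_vector_space]])
  have "lin_ext su (\<lambda>w. prod_list (map (\<lambda>x. - j x) (rev w))) p = 0" if "p \<in> enveloping_rels sg br" for p
    by (rule lin_ext_enveloping_rels[OF vs_u _ _ _ that])
      (simp_all add: incl_rels algebra_over_scale[OF algebra_u] scale_minus algebra_simps)
  from presented_by_lift[OF presented_u vs_u this] obtain S
    where S: "Vector_Spaces.linear su su S"
      and word: "\<And>w. S (prod_list (map j w)) = prod_list (map (\<lambda>x. - j x) (rev w))"
    by blast
  have "S (b * a) = S a * S b" for a b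
  proof (rule presented_by_eqI[OF presented_u, where h = "\<lambda>b. S (b * a)" and h' = "\<lambda>b. S a * S b"])
    show "Vector_Spaces.linear su su (\<lambda>b. S (b * a))"
      by (rule linear_comp[OF linear_mult(2)[OF algebra_u linear_identity[OF vs_u]] S])
    show "Vector_Spaces.linear su su (\<lambda>b. S a * S b)"
      by (rule linear_mult(1)[OF algebra_u S])
    show "S (prod_list (map j w) * a) = S a * S (prod_list (map j w))" for w
    proof (rule presented_by_eqI[OF presented_u, where h = "\<lambda>a. S (prod_list (map j w) * a)"
          and h' = "\<lambda>a. S a * S (prod_list (map j w))"])
      show "Vector_Spaces.linear su su (\<lambda>a. S (prod_list (map j w) * a))"
        by (rule linear_comp[OF linear_mult(1)[OF algebra_u linear_identity[OF vs_u]] S])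
      show "Vector_Spaces.linear su su (\<lambda>a. S a * S (prod_list (map j w)))"
        by (rule linear_mult(2)[OF algebra_u S])
      show "S (prod_list (map j w) * prod_list (map j v)) = S (prod_list (map j v)) * S (prod_list (map j w))" for v
        using word[of "w @ v"] by (simp add: word)
    qed
  qed
  moreover have "S 1 = 1" "S (j x) = - j x" for x
    using word[of "[]"] word[of "[x]"] by simp_all
  ultimately show ?thesis using S by blast
qed

text \<open>Since \<open>\<Delta>\<^sub>0\<close> is cocommutative, the antipode is also a convolution inverse of the identity for the
  opposite coproduct, which is the form needed below.\<close>

lemma antipode0_exists:
  "\<exists>S. Vector_Spaces.linear su su S \<and>
    (\<forall>x. lift2 E su (\<lambda>a b. S b * a) (\<Delta> x) = su (\<epsilon> x) 1) \<and>
    (\<forall>x. lift2 E su (\<lambda>a b. b * S a) (\<Delta> x) = su (\<epsilon> x) 1)"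
proof -
  interpret vector_space su by (rule vs_u)
  obtain S where S: "Vector_Spaces.linear su su S" "S 1 = 1" "\<And>x. S (j x) = - j x"
    "\<And>a b. S (a * b) = S b * S a"
    using antipode_exists by blast
  note id = linear_identity[OF vs_u]
  have left: "bilinear_map su su su (\<lambda>a b. S b * a)" and right: "bilinear_map su su su (\<lambda>a b. b * S a)"
    by (intro bilinear_mapI linear_mult[OF algebra_u] S(1) id)+
  note left_lin = linear_lift2[OF left] and right_lin = linear_lift2[OF right]
  have counit_lin: "Vector_Spaces.linear su su (\<lambda>x. su (\<epsilon> x) 1)"
    using bilinear_mapD(2)[OF bilinear_counit(1)] .
  \<comment> \<open>The two terms of \<open>prim2 E x = x \<otimes> 1 + 1 \<otimes> x\<close> contribute \<open>S(b) x a\<close> and \<open>S(x b) a = - S(b) x a\<close>.\<close>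
  have left_zero: "lift2 E su (\<lambda>a b. S b * a) (prim2 E x * w) = 0" for x w
    by (rule UU.tensor_eqI[OF linear_comp[OF linear_mult(1)[OF algebra_uu linear_identity[OF vs_uu]] left_lin]
          linear_zero[OF vs_uu vs_u]])
      (simp add: prim2_def distrib_right UU.t_mult linearD[OF left_lin] lift2_ten[OF left] S mult.assoc)
  have right_zero: "lift2 E su (\<lambda>a b. b * S a) (w * prim2 E x) = 0" for x w
    by (rule UU.tensor_eqI[OF linear_comp[OF linear_mult(2)[OF algebra_uu linear_identity[OF vs_uu]] right_lin]
          linear_zero[OF vs_uu vs_u]])
      (simp add: prim2_def distrib_left UU.t_mult linearD[OF right_lin] lift2_ten[OF right] S mult.assoc)
  have one: "\<Delta> 1 = ten E 1 1" by (simp add: coprodD UU.t_one)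
  have "lift2 E su (\<lambda>a b. S b * a) (\<Delta> x) = su (\<epsilon> x) 1" for x
    by (rule u_eqI_left[OF linear_comp[OF algebra_homD(1)[OF coprod_hom] left_lin] counit_lin])
      (simp_all add: one coprodD(7,8) coprod_incl left_zero counitD(7,8) counit_incl lift2_ten[OF left] S)
  moreover have "lift2 E su (\<lambda>a b. b * S a) (\<Delta> x) = su (\<epsilon> x) 1" for x
    by (rule u_eqI_right[OF linear_comp[OF algebra_homD(1)[OF coprod_hom] right_lin] counit_lin])
      (simp_all add: one coprodD(7,8) coprod_incl right_zero counitD(7,8) counit_incl lift2_ten[OF right] S)
  ultimately show ?thesis using S(1) by blast
qed

end


section \<open>The twisted coproduct\<close>

lemma algebra_over_fscale:
  assumes "algebra_over s"
  shows "algebra_over (fscale s)"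
proof -
  have "vector_space s" using assms by (rule algebra_over_vector_space)
  then interpret vector_space s .
  show ?thesis
    by (simp add: algebra_over_def vector_space_fscale[OF \<open>vector_space s\<close>] fps_eq_iff fps_mult_nth
        algebra_over_scale[OF assms] scale_sum_right)
qed

lemma linear_fps_nth:
  assumes "vector_space s"
  shows "Vector_Spaces.linear (fscale s) s (\<lambda>F. fps_nth F n)"
  by (simp add: Vector_Spaces.linear_iff assms vector_space_fscale)

lemma klin_fps_X_mult: "algebra_over s \<Longrightarrow> klin s s (\<lambda>F. fps_X * F)"
  by (rule klin_mult_left[OF _ klin_ident])

lemma linear_fscaleI:
  assumes "vector_space s" "vector_space s'"
    and "\<And>n. Vector_Spaces.linear s s' (\<lambda>x. fps_nth (f x) n)"
  shows "Vector_Spaces.linear s (fscale s') f"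
  using assms(3) by (simp add: Vector_Spaces.linear_iff assms(1,2) vector_space_fscale fps_eq_iff)

context enveloping
begin

text \<open>The value on \<open>F \<in> (U \<otimes> U)[[\<hbar>]]\<close> of the map induced by a bilinear map on \<open>U \<times> U\<close>.\<close>

definition contract :: "('k \<Rightarrow> 'w::ring_1 \<Rightarrow> 'w) \<Rightarrow> ('u \<Rightarrow> 'u \<Rightarrow> 'w fps) \<Rightarrow> 'uu fps \<Rightarrow> 'w fps"
  where "contract s T = fps_extend (lift2 E (fscale s) T)"

abbreviation bilin_fps :: "('k \<Rightarrow> 'w::ring_1 \<Rightarrow> 'w) \<Rightarrow> ('u \<Rightarrow> 'u \<Rightarrow> 'w fps) \<Rightarrow> bool"
  where "bilin_fps s \<equiv> bilinear_map su su (fscale s)"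

abbreviation lin_fps :: "('k \<Rightarrow> 'w::ring_1 \<Rightarrow> 'w) \<Rightarrow> ('u \<Rightarrow> 'w fps) \<Rightarrow> bool"
  where "lin_fps s \<equiv> Vector_Spaces.linear su (fscale s)"

lemma klin_contract: "bilin_fps s T \<Longrightarrow> klin suu s (contract s T)"
  unfolding contract_def by (rule klin_fps_extend[OF linear_lift2])

lemma contract_const:
  assumes "bilin_fps s T"
  shows "contract s T (fps_const w) = lift2 E (fscale s) T w"
  unfolding contract_def by (rule fps_extend_const) (rule linearD(4)[OF linear_lift2[OF assms]])

lemma contract_ten: "bilin_fps s T \<Longrightarrow> contract s T (fps_const (ten E a b)) = T a b"
  by (simp add: contract_const lift2_ten)

lemma klin_ten_eqI:
  assumes s: "vector_space s" and P: "klin suu s P" and Q: "klin suu s Q"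
    and ten: "\<And>a b. P (fps_const (ten E a b)) = Q (fps_const (ten E a b))"
  shows "P F = Q F"
proof (rule klin_eqI[OF P Q])
  show "P (fps_const w) = Q (fps_const w)" for w
    by (rule UU.tensor_eqI[OF klin_linear_const[OF P vs_uu s] klin_linear_const[OF Q vs_uu s] ten])
qed

lemma contract_eqI:
  assumes s: "vector_space s" and P: "klin suu s P" and ten: "\<And>a b. P (fps_const (ten E a b)) = T a b"
  shows "contract s T F = P F"
proof -
  note L = klin_linear_const[OF P vs_uu s]
  have T: "bilin_fps s T"
    using linear_comp[OF UU.linear_t(1) L] linear_comp[OF UU.linear_t(2) L]
    by (simp add: bilinear_map_def ten)
  show ?thesis
    by (rule klin_ten_eqI[OF s klin_contract[OF T] P]) (simp add: contract_ten[OF T] ten)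
qed

lemma contract_comp:
  assumes "bilin_fps s L" "klin s s' P" "vector_space s'"
  shows "contract s' (\<lambda>a b. P (L a b)) F = P (contract s L F)"
  by (rule contract_eqI[OF assms(3) klin_comp[OF klin_contract[OF assms(1)] assms(2)]])
    (simp add: contract_ten[OF assms(1)])

lemma contract_add:
  assumes "bilin_fps s T" "bilin_fps s T'"
  shows "contract s (\<lambda>a b. T a b + T' a b) F = contract s T F + contract s T' F"
proof -
  have "lift2 E (fscale s) (\<lambda>a b. T a b + T' a b) = (\<lambda>w. lift2 E (fscale s) T w + lift2 E (fscale s) T' w)"
    by (rule lift2_eqI)
      (simp_all add: linear_add linear_lift2 assms lift2_ten[OF assms(1)] lift2_ten[OF assms(2)])
  then show ?thesis
    by (simp add: contract_def fps_extend_def fps_eq_iff sum.distrib)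
qed

lemma lift2_nth:
  assumes "bilin_fps s T" "vector_space s"
  shows "fps_nth (lift2 E (fscale s) T w) n = lift2 E s (\<lambda>a b. fps_nth (T a b) n) w"
proof -
  have "lift2 E s (\<lambda>a b. fps_nth (T a b) n) = (\<lambda>w. fps_nth (lift2 E (fscale s) T w) n)"
    by (rule lift2_eqI)
      (simp_all add: linear_comp[OF linear_lift2[OF assms(1)] linear_fps_nth[OF assms(2)]]
        lift2_ten[OF assms(1)])
  then show ?thesis by simp
qed

lemma contract_nth_0:
  assumes "bilin_fps s T" "vector_space s"
  shows "fps_nth (contract s T F) 0 = lift2 E s (\<lambda>a b. fps_nth (T a b) 0) (fps_nth F 0)"
  by (simp add: contract_def fps_extend_def lift2_nth[OF assms])

lemma bilin_fps_mult:
  assumes "algebra_over s" "lin_fps s f" "lin_fps s g"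
  shows "bilin_fps s (\<lambda>a b. f b * g a)"
  by (intro bilinear_mapI linear_mult[OF algebra_over_fscale[OF assms(1)]] assms)

end

locale twisted_enveloping = enveloping E
  for E :: "('k::field, 'g::ab_group_add, 'u::ring_1, 'uu::ring_1, 'uuu::ring_1) env" +
  fixes J K :: "'uu fps" and \<Phi> :: "'uuu fps"
  assumes J_nth_0: "fps_nth J 0 = 1"
    and JK: "J * K = 1" and KJ: "K * J = 1"
    and counit_left_J: "fps_map counit_left J = 1" and counit_right_J: "fps_map counit_right J = 1"
    and cocycle: "fps_map (leg12 E) J * fps_map (leg12_3 E) J =
      fps_map (leg23 E) J * fps_map (leg1_23 E) J * \<Phi>"
    and invariant: "commutator (fps_const (prim3 E x)) \<Phi> = 0"
begin

definition coprod_J :: "'u \<Rightarrow> 'uu fps"  (\<open>\<Delta>\<^sub>J\<close>)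
  where "\<Delta>\<^sub>J x = J * fps_const (\<Delta> x) * K"

lemma linear_coprod_J: "Vector_Spaces.linear su (fscale suu) \<Delta>\<^sub>J"
  unfolding coprod_J_def
  by (intro linear_mult algebra_over_fscale algebra_uu
      linear_comp[OF algebra_homD(1)[OF coprod_hom] linear_fps_const] vs_uu)

lemma coprod_J_mult: "\<Delta>\<^sub>J (x * y) = \<Delta>\<^sub>J x * \<Delta>\<^sub>J y"
proof -
  have "\<Delta>\<^sub>J x * \<Delta>\<^sub>J y = J * fps_const (\<Delta> x) * (K * J) * fps_const (\<Delta> y) * K"
    by (simp add: coprod_J_def mult.assoc)
  also have "\<dots> = \<Delta>\<^sub>J (x * y)"
    by (simp add: KJ coprod_J_def coprodD mult.assoc flip: fps_const_mult)
  finally show ?thesis ..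
qed

lemma coprod_J_one: "\<Delta>\<^sub>J 1 = 1"
  by (simp add: coprod_J_def coprodD JK)

lemma K_nth_0: "fps_nth K 0 = 1"
  using arg_cong[OF JK, of "\<lambda>F. fps_nth F 0"] by (simp add: J_nth_0)

lemma coprod_J_nth_0: "fps_nth (\<Delta>\<^sub>J x) 0 = \<Delta> x"
  by (simp add: coprod_J_def J_nth_0 K_nth_0)

lemma counit_coprod_J:
  "fps_map counit_left (\<Delta>\<^sub>J x) = fps_const x"
  "fps_map counit_right (\<Delta>\<^sub>J x) = fps_const x"
proof -
  have *: "fps_map c (\<Delta>\<^sub>J x) = fps_const x"
    if c: "algebra_hom suu su c" and J: "fps_map c J = 1" and \<Delta>: "c (\<Delta> x) = x" for c
  proof -
    note hom = fps_map_hom[OF c algebra_uu algebra_u]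
    have "fps_map c K = fps_map c J * fps_map c K" by (simp add: J)
    also have "\<dots> = 1" by (simp add: JK hom flip: hom(1))
    finally show ?thesis
      by (simp add: coprod_J_def hom J \<Delta> fps_map_const linearD[OF algebra_homD(1)[OF c]])
  qed
  show "fps_map counit_left (\<Delta>\<^sub>J x) = fps_const x"
    by (rule *[OF counit_left_hom counit_left_J counit_left_coprod])
  show "fps_map counit_right (\<Delta>\<^sub>J x) = fps_const x"
    by (rule *[OF counit_right_hom counit_right_J counit_right_coprod])
qed

text \<open>Both sides are conjugates of \<open>coprod3 x\<close>: the left one by \<open>J\<^sup>1\<^sup>,\<^sup>2 J\<^sup>1\<^sup>2\<^sup>,\<^sup>3\<close> and the right one by
  \<open>J\<^sup>2\<^sup>,\<^sup>3 J\<^sup>1\<^sup>,\<^sup>2\<^sup>3\<close>. By the cocycle condition these differ by the invariant \<open>\<Phi>\<close>, which commutes with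
  \<open>coprod3 x\<close>.\<close>

lemma coprod_J_coassoc:
  "contract suuu (\<lambda>a b. fps_map (\<lambda>w. ten21 E w b) (\<Delta>\<^sub>J a)) (\<Delta>\<^sub>J x) =
   contract suuu (\<lambda>a b. fps_map (\<lambda>w. ten3 E a 1 1 * leg23 E w) (\<Delta>\<^sub>J b)) (\<Delta>\<^sub>J x)"
proof -
  note h12 = fps_map_hom[OF leg12_hom algebra_uu algebra_uuu]
  note h23 = fps_map_hom[OF leg23_hom algebra_uu algebra_uuu]
  note h12_3 = fps_map_hom[OF leg12_3_hom algebra_uu algebra_uuu]
  note h1_23 = fps_map_hom[OF leg1_23_hom algebra_uu algebra_uuu]
  have const: "fps_map h (fps_const w) = fps_const (h w)" if "algebra_hom suu suuu h" for h w
    by (simp add: fps_map_const linearD[OF algebra_homD(1)[OF that]])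
  let ?A = "fps_map (leg12 E) J * fps_map (leg12_3 E) J"
  let ?A' = "fps_map (leg12_3 E) K * fps_map (leg12 E) K"
  let ?B = "fps_map (leg23 E) J * fps_map (leg1_23 E) J"
  let ?B' = "fps_map (leg1_23 E) K * fps_map (leg23 E) K"
  have ten21: "fps_map (\<lambda>w. ten21 E w b) (F * G * H) =
      fps_map (leg12 E) F * fps_map (\<lambda>w. ten21 E w b) G * fps_map (leg12 E) H" for b F G H
    by (simp add: fps_eq_iff fps_mult_nth ten21_simps leg12_def UUU.t_mult sum_distrib_right)
  \<comment> \<open>The extension of \<open>\<Delta>\<^sub>J \<otimes> id\<close> to \<open>(U \<otimes> U)[[\<hbar>]]\<close> is conjugation by \<open>J\<^sup>1\<^sup>,\<^sup>2\<close> after \<open>\<Delta>\<^sub>0 \<otimes> id\<close>.\<close>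
  have left: "contract suuu (\<lambda>a b. fps_map (\<lambda>w. ten21 E w b) (\<Delta>\<^sub>J a)) F =
      fps_map (leg12 E) J * fps_map (leg12_3 E) F * fps_map (leg12 E) K" for F
    by (rule contract_eqI[OF vs_uuu])
      (simp_all add: const leg12_3_hom leg12_3_ten coprod_J_def ten21 fps_map_const ten21_simps
        klin_mult_left klin_mult_right klin_fps_map algebra_uuu algebra_homD(1)[OF leg12_3_hom])
  have leg23: "fps_map (\<lambda>w. ten3 E a 1 1 * leg23 E w) F =
      fps_const (ten3 E a 1 1) * fps_map (leg23 E) F" for a F
    by (simp add: fps_eq_iff)
  have commute: "fps_const (ten3 E a 1 1) * fps_map (leg23 E) F =
      fps_map (leg23 E) F * fps_const (ten3 E a 1 1)" for a F
    by (simp add: fps_eq_iff leg23_commute)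
  have right: "contract suuu (\<lambda>a b. fps_map (\<lambda>w. ten3 E a 1 1 * leg23 E w) (\<Delta>\<^sub>J b)) F =
      fps_map (leg23 E) J * fps_map (leg1_23 E) F * fps_map (leg23 E) K" for F
  proof (rule contract_eqI[OF vs_uuu])
    show "klin suu suuu (\<lambda>F. fps_map (leg23 E) J * fps_map (leg1_23 E) F * fps_map (leg23 E) K)"
      by (intro klin_mult_left klin_mult_right klin_fps_map algebra_uuu algebra_homD(1)[OF leg1_23_hom])
    fix a b
    have "fps_map (\<lambda>w. ten3 E a 1 1 * leg23 E w) (\<Delta>\<^sub>J b) =
        (fps_const (ten3 E a 1 1) * fps_map (leg23 E) J) * fps_const (leg23 E (\<Delta> b)) * fps_map (leg23 E) K"
      by (simp add: leg23 coprod_J_def h23 const[OF leg23_hom] mult.assoc)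
    also have "\<dots> = fps_map (leg23 E) J * fps_const (ten3 E a 1 1 * leg23 E (\<Delta> b)) * fps_map (leg23 E) K"
      by (simp add: commute mult.assoc flip: fps_const_mult)
    finally show "fps_map (leg23 E) J * fps_map (leg1_23 E) (fps_const (ten E a b)) * fps_map (leg23 E) K =
        fps_map (\<lambda>w. ten3 E a 1 1 * leg23 E w) (\<Delta>\<^sub>J b)"
      by (simp add: const[OF leg1_23_hom] leg1_23_ten)
  qed
  let ?y = "fps_const (coprod3 x)"
  have central: "?y * \<Phi> = \<Phi> * ?y"
  proof -
    have "fps_const (coprod3 a) * \<Phi> = \<Phi> * fps_const (coprod3 a)" for a
    proof (rule u_eqI_left[where h = "\<lambda>a. fps_const (coprod3 a) * \<Phi>" and s = "fscale suuu"])
      have lin: "Vector_Spaces.linear su (fscale suuu) (\<lambda>a. fps_const (coprod3 a))"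
        by (rule linear_comp[OF algebra_homD(1)[OF coprod3_hom] linear_fps_const[OF vs_uuu]])
      show "Vector_Spaces.linear su (fscale suuu) (\<lambda>a. fps_const (coprod3 a) * \<Phi>)"
        "Vector_Spaces.linear su (fscale suuu) (\<lambda>a. \<Phi> * fps_const (coprod3 a))"
        by (intro linear_mult algebra_over_fscale algebra_uuu lin)+
      show "fps_const (coprod3 1) * \<Phi> = \<Phi> * fps_const (coprod3 1)"
        by (simp add: algebra_homD(2)[OF coprod3_hom])
      fix z a assume IH: "fps_const (coprod3 a) * \<Phi> = \<Phi> * fps_const (coprod3 a)"
      have gen: "fps_const (prim3 E z) * \<Phi> = \<Phi> * fps_const (prim3 E z)"
        using invariant[of z] by (simp add: commutator_def)
      have split: "fps_const (coprod3 (j z * a)) = fps_const (prim3 E z) * fps_const (coprod3 a)"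
        by (simp add: algebra_homD(3)[OF coprod3_hom] coprod3_incl)
      show "fps_const (coprod3 (j z * a)) * \<Phi> = \<Phi> * fps_const (coprod3 (j z * a))"
        unfolding split by (metis IH gen mult.assoc)
    qed
    then show ?thesis .
  qed
  have AA': "?A * ?A' = 1"
  proof -
    have "?A * ?A' = fps_map (leg12 E) J * (fps_map (leg12_3 E) J * fps_map (leg12_3 E) K) * fps_map (leg12 E) K"
      by (simp add: mult.assoc)
    also have "\<dots> = 1" by (simp add: JK h12 h12_3 flip: h12(1) h12_3(1))
    finally show ?thesis .
  qed
  have B'B: "?B' * ?B = 1"
  proof -
    have "?B' * ?B = fps_map (leg1_23 E) K * (fps_map (leg23 E) K * fps_map (leg23 E) J) * fps_map (leg1_23 E) J"
      by (simp add: mult.assoc)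
    also have "\<dots> = 1" by (simp add: KJ h23 h1_23 flip: h23(1) h1_23(1))
    finally show ?thesis .
  qed
  have "?B' = ?B' * (?A * ?A')" by (simp add: AA')
  also have "\<dots> = ?B' * ?B * (\<Phi> * ?A')" by (simp only: cocycle mult.assoc)
  finally have B': "?B' = \<Phi> * ?A'" by (simp add: B'B)
  have "contract suuu (\<lambda>a b. fps_map (\<lambda>w. ten21 E w b) (\<Delta>\<^sub>J a)) (\<Delta>\<^sub>J x) = ?A * ?y * ?A'"
    unfolding left by (simp add: coprod_J_def h12_3 const[OF leg12_3_hom] coprod3_def mult.assoc)
  also have "\<dots> = ?B * (\<Phi> * ?y) * ?A'" by (simp only: cocycle mult.assoc)
  also have "\<dots> = ?B * ?y * (\<Phi> * ?A')" by (simp only: central[symmetric] mult.assoc)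
  also have "\<dots> = ?B * ?y * ?B'" by (simp only: B')
  also have "\<dots> = contract suuu (\<lambda>a b. fps_map (\<lambda>w. ten3 E a 1 1 * leg23 E w) (\<Delta>\<^sub>J b)) (\<Delta>\<^sub>J x)"
    unfolding right by (simp add: coprod_J_def h1_23 const[OF leg1_23_hom] coprod_coassoc mult.assoc)
  finally show ?thesis .
qed


section \<open>Convolution\<close>

text \<open>The product dual to the opposite of \<open>\<Delta>\<^sub>J\<close>, hence the order of the arguments \<open>b\<close> and \<open>a\<close>. For
  values in \<open>K[[\<hbar>]]\<close> this is the product of the quantized function algebra; for values in \<open>U[[\<hbar>]]\<close> it is
  the convolution product in which the antipode is the inverse of the identity. Both are covered
  by allowing values in \<open>W[[\<hbar>]]\<close> for an arbitrary algebra \<open>W\<close>.\<close>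

definition conv :: "('k \<Rightarrow> 'w::ring_1 \<Rightarrow> 'w) \<Rightarrow> ('u \<Rightarrow> 'w fps) \<Rightarrow> ('u \<Rightarrow> 'w fps) \<Rightarrow> 'u \<Rightarrow> 'w fps"
  where "conv s f g x = contract s (\<lambda>a b. f b * g a) (\<Delta>\<^sub>J x)"

definition conv_unit :: "('k \<Rightarrow> 'w::ring_1 \<Rightarrow> 'w) \<Rightarrow> 'u \<Rightarrow> 'w fps"
  where "conv_unit s x = fps_const (s (\<epsilon> x) 1)"

lemma linear_contract_coprod_J:
  assumes "bilin_fps s T" "vector_space s"
  shows "lin_fps s (\<lambda>x. contract s T (\<Delta>\<^sub>J x))"
  by (rule linear_comp[OF linear_coprod_J klin_linear[OF klin_contract[OF assms(1)] vs_uu assms(2)]])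

lemma linear_conv:
  assumes "algebra_over s" "lin_fps s f" "lin_fps s g"
  shows "lin_fps s (conv s f g)"
  unfolding conv_def
  by (rule linear_contract_coprod_J[OF bilin_fps_mult[OF assms] algebra_over_vector_space[OF assms(1)]])

text \<open>Both sides are the value of the trilinear map \<open>\<tau>\<close>, \<open>(a, b, c) \<mapsto> f(c) g(b) h(a)\<close>, on one of the
  two iterated coproducts of \<open>x\<close>.\<close>

lemma conv_assoc:
  assumes s: "algebra_over s" and f: "lin_fps s f" and g: "lin_fps s g" and h: "lin_fps s h"
  shows "conv s (conv s f g) h x = conv s f (conv s g h) x"
proof -
  have vs: "vector_space s" using s by (rule algebra_over_vector_space)
  note sf = algebra_over_fscale[OF s]
  have gh: "bilin_fps s (\<lambda>a b. g b * h a)" and fg: "bilin_fps s (\<lambda>a b. f b * g a)"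
    by (rule bilin_fps_mult[OF s]; fact)+
  define \<tau> where "\<tau> = tensor_lift suuu (ten21 E) (fscale s) (\<lambda>w c. f c * lift2 E (fscale s) (\<lambda>a b. g b * h a) w)"
  have bil: "bilinear_map suu su (fscale s) (\<lambda>w c. f c * lift2 E (fscale s) (\<lambda>a b. g b * h a) w)"
    by (intro bilinear_mapI linear_mult[OF sf] f linear_lift2[OF gh])
  have \<tau>: "Vector_Spaces.linear suuu (fscale s) \<tau>"
    and \<tau>_ten: "\<tau> (ten3 E a b c) = f c * (g b * h a)" for a b c
    unfolding \<tau>_def ten3_def
    by (simp_all add: UUU.linear_tensor_lift[OF bil] UUU.tensor_lift_t[OF bil] lift2_ten[OF gh])
  note \<tau>0 = linearD(4)[OF \<tau>]
  have ten21_lin: "Vector_Spaces.linear suu suuu (\<lambda>w. ten21 E w b)" for b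
    by (rule UUU.linear_t)
  have leg_lin: "Vector_Spaces.linear suu suuu (\<lambda>w. ten3 E a 1 1 * leg23 E w)" for a
    by (rule linear_mult(1)[OF algebra_uuu algebra_homD(1)[OF leg23_hom]])
  have right: "f b * conv s g h a = fps_extend \<tau> (fps_map (\<lambda>w. ten21 E w b) (\<Delta>\<^sub>J a))" for a b
    unfolding conv_def
    by (rule klin_ten_eqI[OF vs klin_mult_left[OF s klin_contract[OF gh]]
          klin_comp[OF klin_fps_map[OF ten21_lin] klin_fps_extend[OF \<tau>]]])
      (simp add: contract_ten[OF gh] fps_map_const ten21_simps fps_extend_const[of \<tau>, OF \<tau>0]
        \<tau>_ten[unfolded ten3_def])
  have left: "conv s f g b * h a = fps_extend \<tau> (fps_map (\<lambda>w. ten3 E a 1 1 * leg23 E w) (\<Delta>\<^sub>J b))" for a b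
    unfolding conv_def
    by (rule klin_ten_eqI[OF vs klin_mult_right[OF s klin_contract[OF fg]]
          klin_comp[OF klin_fps_map[OF leg_lin] klin_fps_extend[OF \<tau>]]])
      (simp add: contract_ten[OF fg] fps_map_const leg23D fps_extend_const[of \<tau>, OF \<tau>0]
        leg23_ten ten3_mult \<tau>_ten mult.assoc)
  have bil_left: "bilin_fps suuu (\<lambda>a b. fps_map (\<lambda>w. ten3 E a 1 1 * leg23 E w) (\<Delta>\<^sub>J b))"
  proof (rule bilinear_mapI)
    show "lin_fps suuu (\<lambda>b. fps_map (\<lambda>w. ten3 E a 1 1 * leg23 E w) (\<Delta>\<^sub>J b))" for a
      by (rule linear_comp[OF linear_coprod_J klin_linear[OF klin_fps_map[OF leg_lin] vs_uu vs_uuu]])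
    show "lin_fps suuu (\<lambda>a. fps_map (\<lambda>w. ten3 E a 1 1 * leg23 E w) (\<Delta>\<^sub>J b))" for b
      by (rule linear_fscaleI[OF vs_u vs_uuu]) (simp add: linear_mult(2)[OF algebra_uuu linear_ten3])
  qed
  have bil_right: "bilin_fps suuu (\<lambda>a b. fps_map (\<lambda>w. ten21 E w b) (\<Delta>\<^sub>J a))"
  proof (rule bilinear_mapI)
    show "lin_fps suuu (\<lambda>a. fps_map (\<lambda>w. ten21 E w b) (\<Delta>\<^sub>J a))" for b
      by (rule linear_comp[OF linear_coprod_J klin_linear[OF klin_fps_map[OF ten21_lin] vs_uu vs_uuu]])
    show "lin_fps suuu (\<lambda>b. fps_map (\<lambda>w. ten21 E w b) (\<Delta>\<^sub>J a))" for a
      by (rule linear_fscaleI[OF vs_u vs_uuu]) (simp add: UUU.linear_t(1))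
  qed
  have "conv s (conv s f g) h x = contract s (\<lambda>a b. conv s f g b * h a) (\<Delta>\<^sub>J x)"
    by (simp add: conv_def[of s "conv s f g"])
  also have "\<dots> = fps_extend \<tau> (contract suuu (\<lambda>a b. fps_map (\<lambda>w. ten3 E a 1 1 * leg23 E w) (\<Delta>\<^sub>J b)) (\<Delta>\<^sub>J x))"
    unfolding left by (rule contract_comp[OF bil_left klin_fps_extend[OF \<tau>] vs])
  also have "\<dots> = fps_extend \<tau> (contract suuu (\<lambda>a b. fps_map (\<lambda>w. ten21 E w b) (\<Delta>\<^sub>J a)) (\<Delta>\<^sub>J x))"
    by (simp only: coprod_J_coassoc)
  also have "\<dots> = contract s (\<lambda>a b. f b * conv s g h a) (\<Delta>\<^sub>J x)"
    unfolding right by (rule contract_comp[OF bil_right klin_fps_extend[OF \<tau>] vs, symmetric])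
  also have "\<dots> = conv s f (conv s g h) x"
    by (simp add: conv_def[of s f "conv s g h"])
  finally show ?thesis .
qed

lemma linear_conv_unit:
  assumes s: "algebra_over s"
  shows "lin_fps s (conv_unit s)"
proof -
  have vs: "vector_space s" using s by (rule algebra_over_vector_space)
  have "Vector_Spaces.linear su s (\<lambda>x. s (\<epsilon> x) 1)"
    by (simp add: Vector_Spaces.linear_iff vs vs_u counitD vector_space.vector_space_assms(2,3)[OF vs])
  from linear_comp[OF this linear_fps_const[OF vs]] show ?thesis
    by (simp add: conv_unit_def[abs_def])
qed

lemma conv_unit:
  assumes s: "algebra_over s" and f: "lin_fps s f"
  shows "conv s (conv_unit s) f x = f x" "conv s f (conv_unit s) x = f x"
proof -
  have vs: "vector_space s" using s by (rule algebra_over_vector_space)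
  note one = vector_space.vector_space_assms(4)[OF vs]
  have unit_mult: "fps_const (s c 1) * F = fscale s c F" "F * fps_const (s c 1) = fscale s c F" for c F
    by (simp_all add: fps_eq_iff algebra_over_scale[OF s])
  note ext = klin_fps_extend[OF f] and f0 = linearD(4)[OF f]
  have "conv s (conv_unit s) f x = fps_extend f (fps_map counit_right (\<Delta>\<^sub>J x))"
    unfolding conv_def
    by (rule contract_eqI[OF vs klin_comp[OF klin_fps_map[OF algebra_homD(1)[OF counit_right_hom]] ext]])
      (simp add: fps_map_const linearD[OF algebra_homD(1)[OF counit_right_hom]] counit_right_ten
        fps_extend_const[of f, OF f0] conv_unit_def unit_mult linearD[OF f])
  then show "conv s (conv_unit s) f x = f x"
    by (simp add: counit_coprod_J fps_extend_const[of f, OF f0])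
  have "conv s f (conv_unit s) x = fps_extend f (fps_map counit_left (\<Delta>\<^sub>J x))"
    unfolding conv_def
    by (rule contract_eqI[OF vs klin_comp[OF klin_fps_map[OF algebra_homD(1)[OF counit_left_hom]] ext]])
      (simp add: fps_map_const linearD[OF algebra_homD(1)[OF counit_left_hom]] counit_left_ten
        fps_extend_const[of f, OF f0] conv_unit_def unit_mult linearD[OF f])
  then show "conv s f (conv_unit s) x = f x"
    by (simp add: counit_coprod_J fps_extend_const[of f, OF f0])
qed

lemma conv_add:
  assumes s: "algebra_over s" and "lin_fps s f" "lin_fps s g" "lin_fps s h"
  shows "conv s (\<lambda>x. f x + g x) h x = conv s f h x + conv s g h x"
    "conv s h (\<lambda>x. f x + g x) x = conv s h f x + conv s h g x"
  by (simp_all add: conv_def distrib_left distrib_right contract_add bilin_fps_mult assms)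

lemma conv_fps_X:
  assumes s: "algebra_over s" and f: "lin_fps s f" and g: "lin_fps s g"
  shows "conv s (\<lambda>x. fps_X * f x) g x = fps_X * conv s f g x"
    "conv s f (\<lambda>x. fps_X * g x) x = fps_X * conv s f g x"
proof -
  have swap: "f b * (fps_X * g a) = fps_X * (f b * g a)" for a b
    by (metis fps_mult_fps_X_commute mult.assoc)
  have "contract s (\<lambda>a b. fps_X * (f b * g a)) (\<Delta>\<^sub>J x) = fps_X * contract s (\<lambda>a b. f b * g a) (\<Delta>\<^sub>J x)"
    by (rule contract_comp[OF bilin_fps_mult[OF s f g] klin_fps_X_mult[OF s] algebra_over_vector_space[OF s]])
  then show "conv s (\<lambda>x. fps_X * f x) g x = fps_X * conv s f g x"
    "conv s f (\<lambda>x. fps_X * g x) x = fps_X * conv s f g x"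
    by (simp_all add: conv_def swap mult.assoc)
qed

end


section \<open>The antipode of the twisted coproduct\<close>

text \<open>An \<open>\<hbar>\<close>-linear map that is surjective modulo \<open>\<hbar>\<close> is surjective: a preimage is the series of the
  successive corrections.\<close>

lemma hadic_surjective:
  fixes R :: "('a \<Rightarrow> 'b::ring_1 fps) \<Rightarrow> 'a \<Rightarrow> 'b fps"
  assumes add: "\<And>f g x. f \<in> C \<Longrightarrow> g \<in> C \<Longrightarrow> R (\<lambda>x. f x + g x) x = R f x + R g x"
    and X: "\<And>f x. f \<in> C \<Longrightarrow> R (\<lambda>x. fps_X * f x) x = fps_X * R f x"
    and X_closed: "\<And>f. f \<in> C \<Longrightarrow> (\<lambda>x. fps_X * f x) \<in> C"
    and complete: "\<And>k. (\<And>i. k i \<in> C) \<Longrightarrow> (\<lambda>x. Abs_fps (\<lambda>n. \<Sum>i\<le>n. fps_nth (k i x) (n - i))) \<in> C"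
    and mod: "\<And>f. f \<in> C \<Longrightarrow> \<exists>k\<in>C. \<exists>f'\<in>C. \<forall>x. f x = R k x + fps_X * f' x"
    and f: "f \<in> C"
  shows "\<exists>k\<in>C. \<forall>x. R k x = f x"
proof -
  from mod obtain q N where q: "\<And>f. f \<in> C \<Longrightarrow> q f \<in> C" and N: "\<And>f. f \<in> C \<Longrightarrow> N f \<in> C"
    and qN: "\<And>f x. f \<in> C \<Longrightarrow> f x = R (q f) x + fps_X * N f x"
    by metis
  \<comment> \<open>\<open>q f\<close> is a preimage of \<open>f\<close> modulo \<open>\<hbar>\<close> and \<open>N f\<close> what is left to correct, so \<open>S f = \<Sum>\<^sub>i \<hbar>\<^sup>i q(N\<^sup>i f)\<close>.\<close>
  define S where "S f x = Abs_fps (\<lambda>n. \<Sum>i\<le>n. fps_nth (q ((N ^^ i) f) x) (n - i))" for f x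
  have iter: "(N ^^ i) f \<in> C" if "f \<in> C" for f i
    by (induction i) (simp_all add: that N)
  have S_closed: "S f \<in> C" if "f \<in> C" for f
    unfolding S_def by (rule complete) (rule q[OF iter[OF that]])
  have S_rec: "S f = (\<lambda>x. q f x + fps_X * S (N f) x)" for f
  proof
    fix x
    show "S f x = q f x + fps_X * S (N f) x"
    proof (rule fps_ext)
      fix n
      show "fps_nth (S f x) n = fps_nth (q f x + fps_X * S (N f) x) n"
        by (cases n) (simp_all add: S_def sum.atMost_Suc_shift funpow_Suc_right del: sum.atMost_Suc funpow.simps)
    qed
  qed
  have RS: "R (S f) x = R (q f) x + fps_X * R (S (N f)) x" if "f \<in> C" for f x
    by (subst S_rec) (simp add: add X X_closed q N S_closed that)
  have "fps_nth (R (S f) x) n = fps_nth (f x) n" if "f \<in> C" for f x n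
    using that
  proof (induction n arbitrary: f)
    case 0
    show ?case using arg_cong[OF RS[OF 0, of x], of "\<lambda>F. fps_nth F 0"]
        arg_cong[OF qN[OF 0, of x], of "\<lambda>F. fps_nth F 0"] by simp
  next
    case (Suc n)
    show ?case using arg_cong[OF RS[OF Suc.prems, of x], of "\<lambda>F. fps_nth F (Suc n)"]
        arg_cong[OF qN[OF Suc.prems, of x], of "\<lambda>F. fps_nth F (Suc n)"] Suc.IH[OF N[OF Suc.prems]]
      by simp
  qed
  then show ?thesis using S_closed[OF f] f by (auto intro!: bexI[of _ "S f"] fps_ext)
qed

context twisted_enveloping
begin

lemma lin_fps_closed:
  assumes s: "algebra_over s"
  shows "lin_fps s f \<Longrightarrow> lin_fps s (\<lambda>x. fps_X * f x)"
    and "(\<And>i::nat. lin_fps s (k i)) \<Longrightarrow> lin_fps s (\<lambda>x. Abs_fps (\<lambda>n. \<Sum>i\<le>n. fps_nth (k i x) (n - i)))"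
    and "lin_fps s f \<Longrightarrow> lin_fps s (\<lambda>x. fps_shift 1 (f x))"
proof -
  have vs: "vector_space s" using s by (rule algebra_over_vector_space)
  show "lin_fps s f \<Longrightarrow> lin_fps s (\<lambda>x. fps_X * f x)"
    by (rule linear_mult(1)[OF algebra_over_fscale[OF s]])
  show "lin_fps s (\<lambda>x. Abs_fps (\<lambda>n. \<Sum>i\<le>n. fps_nth (k i x) (n - i)))" if "\<And>i::nat. lin_fps s (k i)"
    by (rule linear_fscaleI[OF vs_u vs])
      (simp add: linear_sum[OF vs_u vs] linear_comp[OF that linear_fps_nth[OF vs]])
  show "lin_fps s (\<lambda>x. fps_shift 1 (f x))" if "lin_fps s f"
    by (rule linear_fscaleI[OF vs_u vs]) (simp add: linear_comp[OF that linear_fps_nth[OF vs]])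
qed

text \<open>Modulo \<open>\<hbar>\<close> the identity has the antipode of \<open>U\<close> as its convolution inverse. Hence left and right
  convolution by the identity are surjective, and the left and the right inverse coincide.\<close>

lemma twisted_antipode_exists:
  "\<exists>S. lin_fps su S \<and> (\<forall>x. conv su S fps_const x = conv_unit su x)
    \<and> (\<forall>x. conv su fps_const S x = conv_unit su x)"
proof -
  note s = algebra_u and vs = vs_u
  obtain S0 where S0: "Vector_Spaces.linear su su S0"
    and S0_left: "\<And>x. lift2 E su (\<lambda>a b. S0 b * a) (\<Delta> x) = su (\<epsilon> x) 1"
    and S0_right: "\<And>x. lift2 E su (\<lambda>a b. b * S0 a) (\<Delta> x) = su (\<epsilon> x) 1"
    using antipode0_exists by blast
  let ?S0 = "\<lambda>x. fps_const (S0 x)" and ?C = "{f. lin_fps su f}"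
  have lin_id: "lin_fps su fps_const" by (rule linear_fps_const[OF vs])
  have lin_S0: "lin_fps su ?S0" by (rule linear_comp[OF S0 lin_id])
  have lin_e: "lin_fps su (conv_unit su)" by (rule linear_conv_unit[OF s])
  have decompose: "h = (\<lambda>x. conv_unit su x + fps_X * fps_shift 1 (h x))"
    if "\<And>x. fps_nth (h x) 0 = su (\<epsilon> x) 1" for h
  proof (intro ext fps_ext)
    show "fps_nth (h x) n = fps_nth (conv_unit su x + fps_X * fps_shift 1 (h x)) n" for x n
      by (simp add: conv_unit_def that)
  qed
  define A where "A x = fps_shift 1 (conv su ?S0 fps_const x)" for x
  define B where "B x = fps_shift 1 (conv su fps_const ?S0 x)" for x
  have "conv su ?S0 fps_const = (\<lambda>x. conv_unit su x + fps_X * A x)" unfolding A_def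
    by (rule decompose)
      (simp add: conv_def contract_nth_0[OF bilin_fps_mult[OF s lin_S0 lin_id] vs] coprod_J_nth_0 S0_left
        del: fps_const_mult)
  then have A: "conv su ?S0 fps_const = (\<lambda>x. conv_unit su x + fps_X * A x)" .
  have "conv su fps_const ?S0 = (\<lambda>x. conv_unit su x + fps_X * B x)" unfolding B_def
    by (rule decompose)
      (simp add: conv_def contract_nth_0[OF bilin_fps_mult[OF s lin_id lin_S0] vs] coprod_J_nth_0 S0_right
        del: fps_const_mult)
  then have B: "conv su fps_const ?S0 = (\<lambda>x. conv_unit su x + fps_X * B x)" .
  have lin_A: "lin_fps su A" and lin_B: "lin_fps su B"
    unfolding A_def B_def by (intro lin_fps_closed(3)[OF s] linear_conv[OF s] lin_id lin_S0)+
  have "\<exists>k\<in>?C. \<forall>x. conv su k fps_const x = conv_unit su x"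
  proof (rule hadic_surjective[where R = "\<lambda>k. conv su k fps_const"])
    fix f assume "f \<in> ?C"
    then have f: "lin_fps su f" by simp
    \<comment> \<open>Modulo \<open>\<hbar>\<close>, convolution by \<open>S0\<close> inverts convolution by the identity; \<open>A\<close> is the error.\<close>
    have "f x = conv su (conv su f ?S0) fps_const x + fps_X * - conv su f A x" for x
      by (simp add: conv_assoc[OF s f lin_S0 lin_id] A conv_add[OF s lin_e _ f] conv_unit[OF s f]
          conv_fps_X(2)[OF s f lin_A] lin_fps_closed(1)[OF s lin_A])
    moreover have "conv su f ?S0 \<in> ?C" "(\<lambda>x. - conv su f A x) \<in> ?C"
      by (simp_all add: linear_conv[OF s f] lin_S0 linear_uminus lin_A)
    ultimately show "\<exists>k\<in>?C. \<exists>f'\<in>?C. \<forall>x. f x = conv su k fps_const x + fps_X * f' x"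
      by (intro bexI[of _ "conv su f ?S0"] bexI[of _ "\<lambda>x. - conv su f A x"] allI)
  qed (simp_all add: conv_add[OF s _ _ lin_id] conv_fps_X[OF s _ lin_id] lin_fps_closed[OF s] lin_e)
  then obtain L where L: "lin_fps su L" "\<And>x. conv su L fps_const x = conv_unit su x" by auto
  have "\<exists>k\<in>?C. \<forall>x. conv su fps_const k x = conv_unit su x"
  proof (rule hadic_surjective[where R = "\<lambda>k. conv su fps_const k"])
    fix f assume "f \<in> ?C"
    then have f: "lin_fps su f" by simp
    have "f x = conv su fps_const (conv su ?S0 f) x + fps_X * - conv su B f x" for x
      by (simp add: conv_assoc[OF s lin_id lin_S0 f, symmetric] B conv_add[OF s lin_e _ f]
          conv_unit[OF s f] conv_fps_X(1)[OF s lin_B f] lin_fps_closed(1)[OF s lin_B])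
    moreover have "conv su ?S0 f \<in> ?C" "(\<lambda>x. - conv su B f x) \<in> ?C"
      by (simp_all add: linear_conv[OF s _ f] lin_S0 linear_uminus lin_B)
    ultimately show "\<exists>k\<in>?C. \<exists>f'\<in>?C. \<forall>x. f x = conv su fps_const k x + fps_X * f' x"
      by (intro bexI[of _ "conv su ?S0 f"] bexI[of _ "\<lambda>x. - conv su B f x"] allI)
  qed (simp_all add: conv_add[OF s _ _ lin_id] conv_fps_X[OF s lin_id] lin_fps_closed[OF s] lin_e)
  then obtain R where R: "lin_fps su R" "\<And>x. conv su fps_const R x = conv_unit su x" by auto
  have "L x = R x" for x
  proof -
    have "L x = conv su L (conv su fps_const R) x"
      using conv_unit(2)[OF s L(1)] by (simp add: R(2)[abs_def])
    also have "\<dots> = conv su (conv su L fps_const) R x"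
      by (rule conv_assoc[OF s L(1) lin_id R(1), symmetric])
    also have "\<dots> = R x"
      using conv_unit(1)[OF s R(1)] by (simp add: L(2)[abs_def])
    finally show ?thesis .
  qed
  then have "L = R" by blast
  then show ?thesis using L R by blast
qed

end


section \<open>Continuity\<close>

text \<open>Convergence of power series means that each coefficient is eventually constant, so expressions
  whose coefficients involve finitely many coefficients of continuous functions are continuous.\<close>

lemma continuous_on_fps_iff:
  fixes h :: "'a::topological_space \<Rightarrow> 'b::group_add fps"
  shows "continuous_on A h \<longleftrightarrow>
    (\<forall>x\<in>A. \<forall>n. \<forall>\<^sub>F y in at x within A. fps_nth (h y) n = fps_nth (h x) n)"
  by (auto simp: continuous_on_def tendsto_fps_iff)

lemma continuous_on_coordinate:
  fixes A :: "('a \<Rightarrow> 'b::topological_space) set"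
  shows "continuous_on A (\<lambda>f. f x)"
  by (rule continuous_on_subset[OF continuous_on_product_coordinates]) simp

lemma continuous_on_fps_series:
  fixes G :: "nat \<Rightarrow> 'a::topological_space \<Rightarrow> 'b::ring_1 fps"
  assumes "\<And>i. continuous_on A (G i)"
  shows "continuous_on A (\<lambda>x. Abs_fps (\<lambda>n. \<Sum>i\<le>n. fps_nth (G i x) (n - i)))"
  unfolding continuous_on_fps_iff
proof (intro ballI allI)
  fix x n assume x: "x \<in> A"
  have "\<forall>\<^sub>F y in at x within A. \<forall>i\<in>{..n}. fps_nth (G i y) (n - i) = fps_nth (G i x) (n - i)"
    by (rule eventually_ball_finite) (use assms x in \<open>auto simp: continuous_on_fps_iff\<close>)
  then show "\<forall>\<^sub>F y in at x within A. fps_nth (Abs_fps (\<lambda>n. \<Sum>i\<le>n. fps_nth (G i y) (n - i))) n =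
      fps_nth (Abs_fps (\<lambda>n. \<Sum>i\<le>n. fps_nth (G i x) (n - i))) n"
    by eventually_elim simp
qed

lemma continuous_on_fps_combination:
  fixes G :: "'c \<Rightarrow> 'a::topological_space \<Rightarrow> 'b::ring_1 fps"
  assumes "finite S" "\<And>z. continuous_on A (G z)"
  shows "continuous_on A (\<lambda>x. \<Sum>z\<in>S. fps_const (c z) * G z x)"
  unfolding continuous_on_fps_iff
proof (intro ballI allI)
  fix x n assume x: "x \<in> A"
  have "\<forall>\<^sub>F y in at x within A. \<forall>z\<in>S. fps_nth (G z y) n = fps_nth (G z x) n"
    by (rule eventually_ball_finite) (use assms x in \<open>auto simp: continuous_on_fps_iff\<close>)
  then show "\<forall>\<^sub>F y in at x within A. fps_nth (\<Sum>z\<in>S. fps_const (c z) * G z y) n =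
      fps_nth (\<Sum>z\<in>S. fps_const (c z) * G z x) n"
    by eventually_elim (simp add: fps_sum_nth cong: sum.cong)
qed

section \<open>The quantized function algebra\<close>

context twisted_enveloping
begin

lemma fps_map_times: "fps_map ((*) c) F = fps_const c * (F :: 'k fps)"
  by (rule fps_ext) simp

abbreviation "sK \<equiv> ((*) :: 'k \<Rightarrow> 'k \<Rightarrow> 'k)"

lemma dual_h_iff: "f \<in> dual_h su \<longleftrightarrow> lin_fps sK f"
  by (simp add: dual_h_def fscale_field)

lemma dual2_h_iff: "T \<in> dual2_h su \<longleftrightarrow> bilin_fps sK T"
  by (auto simp: dual2_h_def dual_h_iff bilinear_map_def)

lemma bilinear_map_swap:
  "bilinear_map s1 s2 s T \<Longrightarrow> bilinear_map s2 s1 s (\<lambda>a b. T b a)"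
  by (simp add: bilinear_map_def)

definition antipode :: "'u \<Rightarrow> 'u fps"
  where "antipode = (SOME S. lin_fps su S \<and> (\<forall>x. conv su S fps_const x = conv_unit su x)
    \<and> (\<forall>x. conv su fps_const S x = conv_unit su x))"

lemma antipode:
  "lin_fps su antipode" "conv su antipode fps_const x = conv_unit su x"
  "conv su fps_const antipode x = conv_unit su x"
  using someI_ex[OF twisted_antipode_exists] unfolding antipode_def by blast+

definition quantized :: "('k, 'u) qfsh"
  where "quantized = \<lparr>
    qscale = su,
    qmult_hat = (\<lambda>T x. contract sK (\<lambda>a b. T b a) (\<Delta>\<^sub>J x)),
    qone = conv_unit sK,
    qcoprod = (\<lambda>f x y. f (x * y)),
    qcounit = (\<lambda>f. f 1),
    qantipode = (\<lambda>f x. fps_extend f (antipode x))\<rparr>"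

lemma quantized_simps [simp]:
  "qscale quantized = su"
  "qmult_hat quantized = (\<lambda>T x. contract sK (\<lambda>a b. T b a) (\<Delta>\<^sub>J x))"
  "qone quantized = conv_unit sK"
  "qcoprod quantized = (\<lambda>f x y. f (x * y))"
  "qcounit quantized = (\<lambda>f. f 1)"
  "qantipode quantized = (\<lambda>f x. fps_extend f (antipode x))"
  by (simp_all add: quantized_def)

lemma qmult_eq: "qmult quantized f g = conv sK f g"
  by (simp add: qmult_def conv_def fun_eq_iff)

lemma vs_K: "vector_space sK" and algebra_K: "algebra_over sK"
  by (rule vector_space_field, rule algebra_over_field)

lemma contract_act:
  assumes "bilin_fps sK T"
  shows "contract sK (\<lambda>a b. c * T a b) F = c * contract sK T F"
  by (rule contract_comp[OF assms klin_mult_left[OF algebra_K klin_ident] vs_K])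

lemma fps_extend_add: "fps_extend (f + g) F = fps_extend f F + fps_extend g F"
  by (simp add: fps_extend_def fps_eq_iff sum.distrib)

lemma fps_extend_act:
  assumes f: "lin_fps sK f"
  shows "fps_extend (act1 c f) F = c * fps_extend f F"
proof (rule klin_eqI[where P = "fps_extend (act1 c f)" and Q = "\<lambda>F. c * fps_extend f F"])
  have cf: "lin_fps sK (act1 c f)"
    unfolding act1_def by (rule linear_mult(1)[OF algebra_over_fscale[OF algebra_K] f])
  show "klin su sK (fps_extend (act1 c f))" by (rule klin_fps_extend[OF cf])
  show "klin su sK (\<lambda>F. c * fps_extend f F)" by (rule klin_mult_left[OF algebra_K klin_fps_extend[OF f]])
  show "fps_extend (act1 c f) (fps_const a) = c * fps_extend f (fps_const a)" for a
    by (simp add: fps_extend_const linearD(4)[OF f] linearD(4)[OF cf]) (simp add: act1_def)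
qed

lemma bilin_fps_product:
  assumes f: "lin_fps s f"
  shows "bilin_fps s (\<lambda>a b. f (a * b))" "bilin_fps s (\<lambda>a b. f (b * a))"
  by (intro bilinear_mapI linear_comp[OF linear_mult(1)[OF algebra_u linear_identity[OF vs_u]] f]
      linear_comp[OF linear_mult(2)[OF algebra_u linear_identity[OF vs_u]] f])+

text \<open>The element \<open>w\<close> is a finite combination of pure tensors, so the left side depends on finitely many
  values of \<open>T\<close>.\<close>

lemma continuous_on_lift2: "continuous_on (dual2_h su) (\<lambda>T. lift2 E (fscale sK) (\<lambda>a b. T b a) w)"
proof -
  obtain p where w: "w = lin_ext suu (\<lambda>(x, y). ten E x y) p"
    using UU.presented unfolding presented_by_def by (metis surjD)
  have eq: "lift2 E (fscale sK) (\<lambda>a b. T b a) w =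
      (\<Sum>z\<in>Poly_Mapping.keys p. fps_const (Poly_Mapping.lookup p z) * T (snd z) (fst z))"
    if "T \<in> dual2_h su" for T
  proof -
    have T: "bilin_fps sK (\<lambda>a b. T b a)"
      using that bilinear_map_swap by (simp add: dual2_h_iff)
    show ?thesis
      unfolding w lin_ext_def
      by (simp add: linearD[OF linear_lift2[OF T]] case_prod_beta lift2_ten[OF T] fps_map_times)
  qed
  have "continuous_on (dual2_h su)
      (\<lambda>T. \<Sum>z\<in>Poly_Mapping.keys p. fps_const (Poly_Mapping.lookup p z) * T (snd z) (fst z))"
    by (rule continuous_on_fps_combination)
      (simp, rule continuous_on_product_then_coordinatewise[OF continuous_on_coordinate])
  then show ?thesis
    by (rule continuous_on_cong[THEN iffD1, OF refl, rotated]) (simp add: eq)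
qed

text \<open>The compatibility of product and coproduct of the quantized function algebra, for arbitrary
  \<open>F\<close> and \<open>G\<close> in place of \<open>\<Delta>\<^sub>J(x)\<close> and \<open>\<Delta>\<^sub>J(y)\<close>; the generality lets \<open>F\<close> be reduced to a pure tensor.\<close>

lemma contract_product:
  assumes f: "lin_fps sK f" and g: "lin_fps sK g"
  shows "contract sK (\<lambda>a b. f b * g a) (F * G) =
    contract sK (\<lambda>a b. contract sK (\<lambda>c d. f (b * d) * g (a * c)) G) F"
proof -
  note K = algebra_over_fscale[OF algebra_K]
  have fg: "bilin_fps sK (\<lambda>a b. f b * g a)" by (rule bilin_fps_mult[OF algebra_K f g])
  have fg': "bilin_fps sK (\<lambda>c d. f (b * d) * g (a * c))" for a b
    by (rule bilin_fps_mult[OF algebra_K]) (rule bilinear_mapD(1)[OF bilin_fps_product(1)] f g)+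
  have "contract sK (\<lambda>c d. f (b * d) * g (a * c)) G =
      contract sK (\<lambda>a b. f b * g a) (fps_const (ten E a b) * G)" for a b
    by (rule contract_eqI[OF vs_K klin_comp[OF klin_mult_left[OF algebra_uu klin_ident] klin_contract[OF fg]]])
      (simp add: UU.t_mult contract_ten[OF fg])
  then show ?thesis
    by (intro contract_eqI[symmetric, OF vs_K
          klin_comp[OF klin_mult_right[OF algebra_uu klin_ident] klin_contract[OF fg]]])
      simp
qed

text \<open>Both left sides apply \<open>f\<close> to a convolution product of the antipode with the identity.\<close>

lemma antipode_contract:
  assumes f: "lin_fps sK f"
  shows "contract sK (\<lambda>a b. fps_extend (\<lambda>c. f (c * a)) (antipode b)) (\<Delta>\<^sub>J x) = f 1 * conv_unit sK x"
    and "contract sK (\<lambda>a b. fps_extend (\<lambda>c. f (b * c)) (antipode a)) (\<Delta>\<^sub>J x) = f 1 * conv_unit sK x"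
proof -
  note ext = klin_fps_extend[OF f] and f0 = linearD(4)[OF f]
  have S: "bilin_fps su (\<lambda>a b. antipode b * fps_const a)" "bilin_fps su (\<lambda>a b. fps_const b * antipode a)"
    by (rule bilin_fps_mult[OF algebra_u] antipode(1) linear_fps_const[OF vs_u])+
  have right: "fps_extend (\<lambda>c. f (c * a)) F = fps_extend f (F * fps_const a)" for a F
    by (rule klin_eqI[OF klin_fps_extend[OF bilinear_mapD(2)[OF bilin_fps_product(1)[OF f]]]
          klin_comp[OF klin_mult_right[OF algebra_u klin_ident] ext]])
      (simp add: fps_extend_const f0)
  have left: "fps_extend (\<lambda>c. f (b * c)) F = fps_extend f (fps_const b * F)" for b F
    by (rule klin_eqI[OF klin_fps_extend[OF bilinear_mapD(1)[OF bilin_fps_product(1)[OF f]]]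
          klin_comp[OF klin_mult_left[OF algebra_u klin_ident] ext]])
      (simp add: fps_extend_const f0)
  have unit: "fps_extend f (conv_unit su x) = f 1 * conv_unit sK x"
    by (simp add: conv_unit_def fps_extend_const f0 linearD(5)[OF f] fps_map_times mult.commute)
  show "contract sK (\<lambda>a b. fps_extend (\<lambda>c. f (c * a)) (antipode b)) (\<Delta>\<^sub>J x) = f 1 * conv_unit sK x"
    using antipode(2)[of x] by (simp add: right contract_comp[OF S(1) ext vs_K] conv_def unit)
  show "contract sK (\<lambda>a b. fps_extend (\<lambda>c. f (b * c)) (antipode a)) (\<Delta>\<^sub>J x) = f 1 * conv_unit sK x"
    using antipode(3)[of x] by (simp add: left contract_comp[OF S(2) ext vs_K] conv_def unit)
qed

lemma qfsh_algebra_quantized: "qfsh_algebra quantized"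
proof -
  note K = algebra_over_fscale[OF algebra_K]
  have unit_nth: "conv_unit sK x * conv_unit sK y = conv_unit sK (x * y)" for x y
    by (simp add: conv_unit_def counitD)
  have "cont_module_hom act2 act1 (dual2_h su) (dual_h su) (qmult_hat quantized)"
    unfolding cont_module_hom_def
  proof (intro conjI ballI allI)
    fix T T' c assume "T \<in> dual2_h su" "T' \<in> dual2_h su"
    then have T: "bilin_fps sK (\<lambda>a b. T b a)" and T': "bilin_fps sK (\<lambda>a b. T' b a)"
      using bilinear_map_swap by (auto simp: dual2_h_iff)
    show "qmult_hat quantized T \<in> dual_h su"
      by (simp add: dual_h_iff linear_contract_coprod_J[OF T vs_K])
    show "qmult_hat quantized (T + T') = qmult_hat quantized T + qmult_hat quantized T'"
      by (simp add: fun_eq_iff contract_add[OF T T'])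
    show "qmult_hat quantized (act2 c T) = act1 c (qmult_hat quantized T)"
      by (simp add: fun_eq_iff act2_def act1_def contract_act[OF T])
  next
    show "continuous_on (dual2_h su) (qmult_hat quantized)"
      unfolding quantized_simps
      by (rule continuous_on_coordinatewise_then_product)
        (unfold contract_def fps_extend_def, rule continuous_on_fps_series, rule continuous_on_lift2)
  qed
  moreover have "cont_module_hom act1 act2 (dual_h su) (dual2_h su) (qcoprod quantized)"
    unfolding cont_module_hom_def
  proof (intro conjI ballI allI)
    show "continuous_on (dual_h su) (qcoprod quantized)"
      unfolding quantized_simps
      by (intro continuous_on_coordinatewise_then_product continuous_on_coordinate)
  qed (simp_all add: dual_h_iff dual2_h_iff bilin_fps_product fun_eq_iff act1_def act2_def)
  moreover have "cont_module_hom act1 (*) (dual_h su) UNIV (qcounit quantized)"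
    by (simp add: cont_module_hom_def act1_def continuous_on_coordinate)
  moreover have "cont_module_hom act1 act1 (dual_h su) (dual_h su) (qantipode quantized)"
    unfolding cont_module_hom_def
  proof (intro conjI ballI allI)
    fix f g c assume "f \<in> dual_h su"
    then have f: "lin_fps sK f" by (simp add: dual_h_iff)
    show "qantipode quantized f \<in> dual_h su"
      by (simp add: dual_h_iff
          linear_comp[OF antipode(1) klin_linear[OF klin_fps_extend[OF f] vs_u vs_K]])
    show "qantipode quantized (f + g) = qantipode quantized f + qantipode quantized g"
      by (simp add: fun_eq_iff fps_extend_add)
    show "qantipode quantized (act1 c f) = act1 c (qantipode quantized f)"
      by (simp add: fun_eq_iff fps_extend_act[OF f]) (simp add: act1_def)
  next
    show "continuous_on (dual_h su) (qantipode quantized)"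
      unfolding quantized_simps
      by (rule continuous_on_coordinatewise_then_product)
        (unfold fps_extend_def, rule continuous_on_fps_series, rule continuous_on_coordinate)
  qed
  moreover have "qone quantized \<in> dual_h su"
    by (simp add: dual_h_iff linear_conv_unit[OF algebra_K])
  moreover have "qmult quantized (qmult quantized f g) h = qmult quantized f (qmult quantized g h)"
    if "f \<in> dual_h su" "g \<in> dual_h su" "h \<in> dual_h su" for f g h
    using that by (simp add: qmult_eq fun_eq_iff dual_h_iff conv_assoc[OF algebra_K])
  moreover have "qmult quantized (qone quantized) f = f \<and> qmult quantized f (qone quantized) = f"
    if "f \<in> dual_h su" for f
    using that by (simp add: qmult_eq fun_eq_iff dual_h_iff conv_unit[OF algebra_K])
  moreover have "qcoprod quantized (qmult quantized f g) x y =
      qmult_hat quantized (\<lambda>a b. qmult_hat quantized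
        (\<lambda>c d. qcoprod quantized f a c * qcoprod quantized g b d) y) x"
    if "f \<in> dual_h su" "g \<in> dual_h su" for f g x y
    using that
    by (simp add: qmult_eq conv_def coprod_J_mult dual_h_iff contract_product)
  moreover have "qmult quantized f g 1 = f 1 * g 1" if "f \<in> dual_h su" "g \<in> dual_h su" for f g
    using that
    by (simp add: qmult_eq conv_def coprod_J_one dual_h_iff
        contract_ten[OF bilin_fps_mult[OF algebra_K], of f g 1 1, unfolded UU.t_one fps_const_1_eq_1])
  moreover have "qmult_hat quantized (\<lambda>x y. qantipode quantized (\<lambda>a. qcoprod quantized f a y) x) =
        act1 (qcounit quantized f) (qone quantized)"
      "qmult_hat quantized (\<lambda>x y. qantipode quantized (\<lambda>b. qcoprod quantized f x b) y) =
        act1 (qcounit quantized f) (qone quantized)" if "f \<in> dual_h su" for f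
    using that by (simp_all add: dual_h_iff fun_eq_iff antipode_contract act1_def)
  ultimately show ?thesis
    unfolding qfsh_algebra_def Let_def
    by (simp add: vs_u mult.assoc unit_nth counitD conv_unit_def)
qed

end


section \<open>The classical limit\<close>

context twisted_enveloping
begin

definition reduce :: "('u \<Rightarrow> 'k fps) \<Rightarrow> 'u \<Rightarrow> 'k"
  where "reduce f x = fps_nth (f x) 0"

lemma linear_reduce: "lin_fps sK f \<Longrightarrow> Vector_Spaces.linear su sK (\<lambda>x. fps_nth (f x) n)"
  by (rule linear_comp[OF _ linear_fps_nth[OF vs_K]])

lemma bilinear_mult: 
  assumes "Vector_Spaces.linear su sK f" "Vector_Spaces.linear su sK g"
  shows "bilinear_map su su sK (\<lambda>a b. f a * g b)"
  by (intro bilinear_mapI linear_mult[OF algebra_K] assms)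

lemma lin_fps_const:
  assumes "Vector_Spaces.linear su sK f"
  shows "lin_fps sK (\<lambda>x. fps_const (f x))"
  by (rule linear_comp[OF assms linear_fps_const[OF vs_K]])

text \<open>Modulo \<open>\<hbar>\<close> the coproduct \<open>\<Delta>\<^sub>J\<close> is \<open>\<Delta>\<^sub>0\<close>, and passing to the opposite has no effect there since \<open>\<Delta>\<^sub>0\<close> is
  cocommutative.\<close>

lemma reduction_iso_quantized: "reduction_iso quantized reduce (functions_G E \<delta>)"
proof -
  have "reduce ` dual_h su = dual su"
  proof (intro equalityI subsetI)
    fix h assume "h \<in> dual su"
    then have "(\<lambda>x. fps_const (h x)) \<in> dual_h su"
      by (simp add: dual_def dual_h_iff lin_fps_const)
    moreover have "h = reduce (\<lambda>x. fps_const (h x))"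
      by (simp add: reduce_def fun_eq_iff)
    ultimately show "h \<in> reduce ` dual_h su" by blast
  qed (auto simp: dual_def dual_h_iff reduce_def[abs_def] linear_reduce)
  moreover have "(\<forall>x. reduce f x = 0) \<longleftrightarrow> (\<exists>g\<in>dual_h su. f = act1 fps_X g)" if f: "f \<in> dual_h su" for f
  proof
    assume zero: "\<forall>x. reduce f x = 0"
    have "(\<lambda>x. fps_shift 1 (f x)) \<in> dual_h su"
      using f by (simp add: dual_h_iff lin_fps_closed(3)[OF algebra_K, simplified])
    moreover have "f = act1 fps_X (\<lambda>x. fps_shift 1 (f x))"
      using zero by (auto simp: act1_def fun_eq_iff fps_eq_iff reduce_def)
    ultimately show "\<exists>g\<in>dual_h su. f = act1 fps_X g" by blast
  qed (auto simp: reduce_def act1_def)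
  moreover have "continuous_on (dual_h su) (\<lambda>f x. fps_const (reduce f x))"
  proof (rule continuous_on_coordinatewise_then_product)
    fix x
    have "\<forall>f\<in>dual_h su. \<forall>n. \<forall>\<^sub>F g in at f within dual_h su. fps_nth (g x) n = fps_nth (f x) n"
      using continuous_on_coordinate[of "dual_h su" x] by (simp only: continuous_on_fps_iff)
    then show "continuous_on (dual_h su) (\<lambda>f. fps_const (reduce f x))"
      by (simp add: continuous_on_fps_iff reduce_def)
  qed
  moreover have "reduce (qmult quantized f g) = pmult (functions_G E \<delta>) (reduce f) (reduce g)"
    if "f \<in> dual_h su" "g \<in> dual_h su" for f g
  proof
    fix x
    have f: "lin_fps sK f" and g: "lin_fps sK g" using that by (simp_all add: dual_h_iff)
    have "reduce (qmult quantized f g) x = lift2 E sK (\<lambda>a b. reduce f b * reduce g a) (\<Delta> x)"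
      by (simp add: reduce_def qmult_eq conv_def coprod_J_nth_0
          contract_nth_0[OF bilin_fps_mult[OF algebra_K f g] vs_K])
    also have "\<dots> = lift2 E sK (\<lambda>a b. reduce f a * reduce g b) (\<Delta> x)"
      by (subst lift2_flip[where f = "\<lambda>a b. reduce f a * reduce g b"])
        (simp_all add: flip_coprod bilinear_mult linear_reduce f g reduce_def)
    finally show "reduce (qmult quantized f g) x = pmult (functions_G E \<delta>) (reduce f) (reduce g) x"
      by (simp add: functions_G_def)
  qed
  ultimately show ?thesis
    unfolding reduction_iso_def Let_def
    by (simp add: functions_G_def reduce_def act1_def conv_unit_def fun_eq_iff)
qed

lemma flip_flip: "flip (flip w) = w"
  by (rule UU.tensor_eqI[OF algebra_homD(1)[OF algebra_hom_comp[OF flip_hom flip_hom]] linear_identity[OF vs_uu]])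
    (simp add: flip_ten)

text \<open>To first order in \<open>\<hbar>\<close> the coproduct \<open>\<Delta>\<^sub>J\<close> differs from its opposite by \<open>[J\<^sub>1 - J\<^sub>1\<^sup>2\<^sup>1, \<Delta>\<^sub>0] = -[\<Delta>\<^sub>0, r]\<close>.
  The sign is why the product is taken dual to the opposite of \<open>\<Delta>\<^sub>J\<close>.\<close>

lemma coprod_J_nth_1_antisymmetric:
  assumes "alt2 E (fps_nth J 1) = r"
  shows "fps_nth (\<Delta>\<^sub>J x) 1 - flip (fps_nth (\<Delta>\<^sub>J x) 1) = - commutator (\<Delta> x) r"
proof -
  have "fps_nth (J * K) 1 = 0" by (simp add: JK)
  then have K1: "fps_nth K 1 = - fps_nth J 1"
    by (simp add: fps_mult_nth_1 J_nth_0 K_nth_0 add_eq_0_iff2 del: One_nat_def)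
  have D1: "fps_nth (\<Delta>\<^sub>J x) 1 = fps_nth J 1 * \<Delta> x - \<Delta> x * fps_nth J 1"
    unfolding coprod_J_def by (simp add: fps_mult_nth_1 J_nth_0 K_nth_0 K1 del: One_nat_def)
  show ?thesis
    unfolding D1 assms[symmetric] by (simp add: commutator_def flipD flip_coprod alt2_eq algebra_simps)
qed

lemma quantization_quantized:
  assumes r: "alt2 E (fps_nth J 1) = r" and \<delta>: "\<And>x. \<delta> x = commutator (prim2 E x) r"
  shows "quantization quantized reduce (functions_G E \<delta>)"
proof -
  have "\<exists>h\<in>dual_h su. (\<forall>x. qmult quantized f g x - qmult quantized g f x = fps_X * h x) \<and>
      reduce h = pbracket (functions_G E \<delta>) (reduce f) (reduce g)"
    if "f \<in> dual_h su" "g \<in> dual_h su" for f g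
  proof -
    have f: "lin_fps sK f" and g: "lin_fps sK g" using that by (simp_all add: dual_h_iff)
    let ?T = "\<lambda>a b. f b * g a" and ?b = "\<lambda>a b. reduce f a * reduce g b"
    let ?d = "\<lambda>x. conv sK f g x - conv sK g f x"
    have T: "bilin_fps sK ?T" by (rule bilin_fps_mult[OF algebra_K f g])
    have b: "bilinear_map su su sK ?b"
      unfolding reduce_def by (rule bilinear_mult; rule linear_reduce; fact)
    note b_swap = bilinear_map_swap[OF b]
    \<comment> \<open>Exchanging \<open>f\<close> and \<open>g\<close> amounts to replacing \<open>\<Delta>\<^sub>J\<close> by its opposite.\<close>
    have opposite: "conv sK g f x = contract sK ?T (fps_map flip (\<Delta>\<^sub>J x))" for x
      unfolding conv_def
      by (rule contract_eqI[OF vs_K klin_comp[OF klin_fps_map[OF algebra_homD(1)[OF flip_hom]] klin_contract[OF T]]])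
        (simp add: fps_map_const flipD flip_ten contract_ten[OF T] mult.commute)
    have T0: "fps_nth (lift2 E (fscale sK) ?T w) 0 = lift2 E sK (\<lambda>a b. ?b b a) w" for w
      by (simp add: lift2_nth[OF T vs_K] reduce_def)
    have d0: "fps_nth (?d x) 0 = 0" for x
      by (simp add: opposite) (simp add: conv_def contract_def fps_extend_def coprod_J_nth_0 flip_coprod)
    have d1: "fps_nth (?d x) 1 = lift2 E sK ?b (commutator (\<Delta> x) r)" for x
    proof -
      have "fps_nth (?d x) 1 =
          fps_nth (lift2 E (fscale sK) ?T (fps_nth (\<Delta>\<^sub>J x) 1)) 0 -
          fps_nth (lift2 E (fscale sK) ?T (flip (fps_nth (\<Delta>\<^sub>J x) 1))) 0"
        unfolding opposite by (simp add: conv_def contract_def fps_extend_def coprod_J_nth_0 flip_coprod)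
      also have "\<dots> = lift2 E sK (\<lambda>a b. ?b b a) (- commutator (\<Delta> x) r)"
        by (simp only: T0 linearD(2)[OF linear_lift2[OF b_swap], symmetric] coprod_J_nth_1_antisymmetric[OF r])
      also have "\<dots> = lift2 E sK ?b (- flip (commutator (\<Delta> x) r))"
        by (simp only: lift2_flip[OF b] flipD)
      also have "- flip (commutator (\<Delta> x) r) = commutator (\<Delta> x) r"
        by (simp add: commutator_def flipD flip_coprod alt2_eq flip_flip algebra_simps flip: r)
      finally show ?thesis .
    qed
    let ?h = "\<lambda>x. fps_shift 1 (?d x)"
    have "lin_fps sK ?h"
      by (intro lin_fps_closed(3)[OF algebra_K] linear_diff linear_conv algebra_K f g)
    moreover have "?d x = fps_X * ?h x" for x
      using d0[of x] by (auto simp: fps_eq_iff)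
    moreover have "reduce ?h = pbracket (functions_G E \<delta>) (reduce f) (reduce g)"
    proof
      show "reduce ?h x = pbracket (functions_G E \<delta>) (reduce f) (reduce g) x" for x
        using d1[of x] by (simp add: reduce_def functions_G_def co_poisson_eq[OF \<delta>])
    qed
    ultimately show ?thesis
      by (intro bexI[of _ ?h]) (simp_all add: qmult_eq dual_h_iff)
  qed
  then show ?thesis
    by (simp add: quantization_def qfsh_algebra_quantized reduction_iso_quantized)
qed


section \<open>Invariant functions\<close>

definition invariant_series :: "(nat \<Rightarrow> 'u \<Rightarrow> 'k) \<Rightarrow> 'u \<Rightarrow> 'k fps"
  where "invariant_series F x = Abs_fps (\<lambda>n. F n x)"

lemma contract_trace:
  assumes T: "bilin_fps s T" and s: "vector_space s"
    and trace: "\<And>a a' b b'. T (a * a') (b * b') = T (a' * a) (b' * b)"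
  shows "contract s T (F * G) = contract s T (G * F)"
proof -
  note left = klin_comp[OF klin_mult_left[OF algebra_uu klin_ident] klin_contract[OF T]]
  note right = klin_comp[OF klin_mult_right[OF algebra_uu klin_ident] klin_contract[OF T]]
  have tens: "contract s T (fps_const (ten E a b) * fps_const (ten E a' b')) =
      contract s T (fps_const (ten E a' b') * fps_const (ten E a b))" for a b a' b'
    by (simp add: UU.t_mult contract_ten[OF T] trace)
  have "contract s T (fps_const (ten E a b) * G) = contract s T (G * fps_const (ten E a b))" for a b G
    by (rule klin_ten_eqI[OF s left right tens])
  then show ?thesis by (rule klin_ten_eqI[OF s right left])
qed

text \<open>The form \<open>f \<otimes> g\<close> is a trace, so \<open>J\<close> may be moved cyclically past \<open>\<Delta>\<^sub>0(x)\<close>, where it cancels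
  against its inverse.\<close>

lemma conv_invariant:
  assumes f: "lin_fps sK f" "\<And>x y. f (x * y) = f (y * x)"
    and g: "lin_fps sK g" "\<And>x y. g (x * y) = g (y * x)"
  shows "conv sK f g x = lift2 E (fscale sK) (\<lambda>a b. f b * g a) (\<Delta> x)"
proof -
  let ?T = "\<lambda>a b. f b * g a"
  have T: "bilin_fps sK ?T" by (rule bilin_fps_mult[OF algebra_K f(1) g(1)])
  have trace: "?T (a * a') (b * b') = ?T (a' * a) (b' * b)" for a a' b b'
    by (simp only: f(2)[of b b'] g(2)[of a a'])
  have "conv sK f g x = contract sK ?T (J * (fps_const (\<Delta> x) * K))"
    by (simp add: conv_def coprod_J_def mult.assoc)
  also have "\<dots> = contract sK ?T (fps_const (\<Delta> x) * K * J)"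
    by (rule contract_trace[OF T vs_K trace])
  also have "\<dots> = lift2 E (fscale sK) ?T (\<Delta> x)"
    by (simp add: KJ mult.assoc contract_const[OF T])
  finally show ?thesis .
qed

lemma invariantsD:
  assumes "F \<in> series (invariants E)"
  shows "Vector_Spaces.linear su sK (F n)" "F n (x * y) = F n (y * x)"
    "lin_fps sK (invariant_series F)" "invariant_series F (x * y) = invariant_series F (y * x)"
proof -
  have F: "Vector_Spaces.linear su sK (F n)" "F n (x * y) = F n (y * x)" for n x y
    using assms unfolding series_def invariants_def dual_def by blast+
  show "Vector_Spaces.linear su sK (F n)" "F n (x * y) = F n (y * x)" by (rule F)+
  show "lin_fps sK (invariant_series F)"
    by (rule linear_fscaleI[OF vs_u vs_K]) (simp add: invariant_series_def F(1))
  show "invariant_series F (x * y) = invariant_series F (y * x)"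
    by (simp add: invariant_series_def F(2)[of _ x y])
qed

lemma lift2_sum:
  assumes "\<And>i. i \<in> S \<Longrightarrow> bilinear_map su su s (f i)" "vector_space s"
  shows "lift2 E s (\<lambda>a b. \<Sum>i\<in>S. f i a b) w = (\<Sum>i\<in>S. lift2 E s (f i) w)"
proof -
  have "lift2 E s (\<lambda>a b. \<Sum>i\<in>S. f i a b) = (\<lambda>w. \<Sum>i\<in>S. lift2 E s (f i) w)"
    by (rule lift2_eqI) (simp_all add: linear_sum[OF vs_uu] assms linear_lift2 lift2_ten)
  then show ?thesis by simp
qed

lemma invariant_series_mult:
  assumes F: "F \<in> series (invariants E)" and G: "G \<in> series (invariants E)"
  shows "invariant_series (series_mult (functions_G E \<delta>) F G) =
      qmult quantized (invariant_series F) (invariant_series G)"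
proof (intro ext fps_ext)
  fix x n
  let ?f = "invariant_series F" and ?g = "invariant_series G"
  note f = invariantsD(3,4)[OF F] and g = invariantsD(3,4)[OF G]
  have b: "bilinear_map su su sK (\<lambda>a b. F i a * G k b)" for i k
    by (rule bilinear_mult[OF invariantsD(1)[OF F] invariantsD(1)[OF G]])
  have "fps_nth (qmult quantized ?f ?g x) n = fps_nth (lift2 E (fscale sK) (\<lambda>a b. ?f b * ?g a) (\<Delta> x)) n"
    by (simp add: qmult_eq conv_invariant[OF f g])
  also have "\<dots> = lift2 E sK (\<lambda>a b. \<Sum>i\<le>n. F i b * G (n - i) a) (\<Delta> x)"
    unfolding lift2_nth[OF bilin_fps_mult[OF algebra_K f(1) g(1)] vs_K]
    by (simp add: fps_mult_nth invariant_series_def atLeast0AtMost)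
  also have "\<dots> = (\<Sum>i\<le>n. lift2 E sK (\<lambda>a b. F i b * G (n - i) a) (\<Delta> x))"
    by (rule lift2_sum[OF bilinear_map_swap[OF b] vs_K])
  also have "\<dots> = (\<Sum>i\<le>n. lift2 E sK (\<lambda>a b. F i a * G (n - i) b) (\<Delta> x))"
    by (simp only: lift2_flip[OF b] flip_coprod)
  also have "\<dots> = fps_nth (invariant_series (series_mult (functions_G E \<delta>) F G) x) n"
    by (simp add: invariant_series_def series_mult_def functions_G_def)
  finally show "fps_nth (invariant_series (series_mult (functions_G E \<delta>) F G) x) n =
      fps_nth (qmult quantized ?f ?g x) n"
    by (rule sym)
qed

lemma series_algebra_hom_invariant_series:
  "series_algebra_hom (functions_G E \<delta>) (invariants E) quantized invariant_series"
  unfolding series_algebra_hom_def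
proof (intro conjI ballI allI)
  fix F G c assume F: "F \<in> series (invariants E)"
  show "invariant_series F \<in> dual_h (qscale quantized)"
    by (simp add: dual_h_iff invariantsD(3)[OF F])
  show "invariant_series (F + G) = invariant_series F + invariant_series G"
    by (simp add: invariant_series_def fun_eq_iff fps_eq_iff)
  show "invariant_series (series_act c F) = act1 c (invariant_series F)"
    by (simp add: invariant_series_def fun_eq_iff fps_eq_iff act1_def series_act_def fps_mult_nth atLeast0AtMost)
  show "invariant_series (series_mult (functions_G E \<delta>) F G) =
      qmult quantized (invariant_series F) (invariant_series G)"
    if "G \<in> series (invariants E)"
    by (rule invariant_series_mult[OF F that])
next
  show "invariant_series (series_one (functions_G E \<delta>)) = qone quantized"
    by (simp add: invariant_series_def series_one_def functions_G_def conv_unit_def fun_eq_iff fps_eq_iff)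
qed

lemma inj_invariant_series: "inj invariant_series"
  by (rule injI) (simp add: invariant_series_def fun_eq_iff fps_eq_iff)

lemma reduce_invariant_series: "reduce (invariant_series F) = F 0"
  by (simp add: reduce_def invariant_series_def fun_eq_iff)

end

theorem proposition6p1:
  fixes E :: "('k::field_char_0, 'g::ab_group_add, 'u::ring_1, 'uu::ring_1, 'uuu::ring_1) enveloping"
    and \<delta> :: "'g \<Rightarrow> 'uu" and r :: 'uu and Z :: 'uuu
  assumes "is_enveloping E"
    and "finite_dimensional (gscale E)"
    and "coboundary_lie_bialgebra E \<delta> r Z"
    and "\<exists>J \<Phi>. twist_quantization E r Z J \<Phi>"
  shows "\<exists>(H :: ('k, 'u) qfsh) \<pi> i.
    quantization H \<pi> (functions_G E \<delta>) \<and>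
    series_algebra_hom (functions_G E \<delta>) (invariants E) H i \<and>
    inj_on i (series (invariants E)) \<and>
    (\<forall>F\<in>series (invariants E). \<pi> (i F) = F 0)"
proof -
  interpret enveloping E by (rule enveloping.intro) fact
  obtain J \<Phi> where tw: "twist_quantization E r Z J \<Phi>" using assms(4) by blast
  have J0: "fps_nth J 0 = 1" using tw by (simp add: twist_quantization_def)
  define K where "K = fps_right_inverse J 1"
  have JK: "J * K = 1" "K * J = 1"
    unfolding K_def by (rule fps_right_inverse fps_left_inverse'[of 1]; simp add: J0)+
  interpret twisted_enveloping E J K \<Phi>
    using tw by unfold_locales
      (simp_all add: J0 JK twist_quantization_def counit_left_def counit_right_def)
  have "alt2 E (fps_nth J 1) = r"
    using tw by (simp add: twist_quantization_def Let_def)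
  moreover have "\<delta> x = commutator (prim2 E x) r" for x
    using assms(3) by (simp add: coboundary_lie_bialgebra_def)
  ultimately have "quantization quantized reduce (functions_G E \<delta>)"
    by (rule quantization_quantized)
  then show ?thesis
    using series_algebra_hom_invariant_series inj_on_subset[OF inj_invariant_series subset_UNIV]
      reduce_invariant_series by blast
qed

end
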